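(* Let $p,q$ be coprime positive integers and let $VT_{p,q}^1$ be the virtual knot obtained from the standard $(p,q)$-torus knot diagram by replacing by virtual crossings all classical crossings lying on one overstrand. Then $VT_{p,q}^1$ is virtually null-homotopic and its virtual unknotting number is \[ \mathrm{vu}(VT_{p,q}^1)=\frac{(p-1)(q-1)}{2}. \]
   Context: Virtual knots: a virtual knot diagram is a knot diagram some of whose crossings are virtual crossings, drawn with a small circle and carrying no over/under information; the other crossings are classical. Two diagrams represent the same virtual knot iff they are related by planar isotopy and generalized Reidemeister moves: the classical moves R1, R2, R3, the virtual moves VR1, VR2, VR3 (the analogues of R1–R3 with only virtual crossings), and the mixed move MR (a strand with two virtual crossings slides past a classical crossing). A crossing change exchanges over- and understrand at a classical crossing. A virtual knot is virtually null-homotopic if it can be turned into the unknot by generalized Reidemeister moves and crossing changes; for such a $K$, the virtual unknotting number $\mathrm{vu}(K)$ is the minimal number of crossing changes needed (together with any number of generalized Reidemeister moves) to turn $K$ into the unknot. Braid conventions: braids on $p$ strands are drawn horizontally, oriented left to right, with positions $1,\dots,p$ numbered from top to bottom, and words are read left to right. The generator $\sigma_m$ ($1\le m\le p-1$) is a classical crossing at which the strand in position $m$ moves to position $m+1$, passing over the strand moving from position $m+1$ to position $m$. The standard $(p,q)$-torus knot diagram is the closure of $(\sigma_1\sigma_2\cdots\sigma_{p-1})^q$. In each block $\sigma_1\cdots\sigma_{p-1}$, one strand passes over the other $p-1$ strands; call these strands the $q$ overstrands. $VT^1_{p,q}$ is the closure of the virtual braid obtained by replacing the $p-1$ crossings of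 the first block by virtual crossings. *)

theory Defs
  imports Complex_Main
begin

text \<open>A letter of a signed Gauss code is (crossing label, passes over?, sign positive?).
  A virtual knot diagram is encoded by the cyclic word of classical crossings met
  along the knot; virtual crossings do not appear.\<close>

type_synonym gletter = "nat \<times> bool \<times> bool"
type_synonym gcode = "gletter list"

definition labels :: "gcode \<Rightarrow> nat set" where
  "labels w = fst ` set w"

definition gc_wf :: "gcode \<Rightarrow> bool" where
  "gc_wf w \<longleftrightarrow> (\<forall>a \<in> labels w. \<exists>s.
      filter (\<lambda>l. fst l = a) w = [(a, True, s), (a, False, s)] \<or>
      filter (\<lambda>l. fst l = a) w = [(a, False, s), (a, True, s)])"

text \<open>Local model of an oriented R3 move. Strands 0,1,2 are three straight lines,
  directed left to right and numbered by their position at the left (0 on top),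
  forming the braid sigma1 sigma2 sigma1 (side False) resp. sigma2 sigma1 sigma2
  (side True). h gives the heights (h x > h y: strand x passes over strand y),
  r x says that strand x is in fact oriented the other way, c x y (x<y) is the
  label of the crossing of strands x and y.\<close>

definition r3_letter ::
  "(nat \<Rightarrow> nat \<Rightarrow> nat) \<Rightarrow> (nat \<Rightarrow> nat) \<Rightarrow> (nat \<Rightarrow> bool) \<Rightarrow> nat \<Rightarrow> nat \<Rightarrow> gletter" where
  "r3_letter c h r x y =
     (c (min x y) (max x y), h y < h x,
      (h (max x y) < h (min x y)) \<noteq> (r x \<noteq> r y))"

definition r3_others :: "nat \<Rightarrow> nat \<times> nat" where
  "r3_others x = (if x = 0 then (1, 2) else if x = 1 then (0, 2) else (0, 1))"

definition r3_seg ::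
  "bool \<Rightarrow> (nat \<Rightarrow> nat \<Rightarrow> nat) \<Rightarrow> (nat \<Rightarrow> nat) \<Rightarrow> (nat \<Rightarrow> bool) \<Rightarrow> nat \<Rightarrow> gcode" where
  "r3_seg side c h r x =
     (let (y, z) = r3_others x;
          s = [r3_letter c h r x y, r3_letter c h r x z]
      in if side \<noteq> r x then rev s else s)"

definition vk_move :: "gcode \<Rightarrow> gcode \<Rightarrow> bool" where
  "vk_move w w' \<longleftrightarrow> gc_wf w \<and> gc_wf w' \<and>
    (w' = rotate1 w
     \<or> (\<exists>f. inj_on f (labels w) \<and> w' = map (\<lambda>(a, ov, s). (f a, ov, s)) w)
     \<or> (\<exists>u v a ov s. w = u @ v \<and> w' = u @ [(a, ov, s), (a, \<not> ov, s)] @ v)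
     \<or> (\<exists>u v x a b s. w = u @ v @ x \<and>
          (w' = u @ [(a, True, s), (b, True, \<not> s)] @ v @ [(a, False, s), (b, False, \<not> s)] @ x \<or>
           w' = u @ [(a, True, s), (b, True, \<not> s)] @ v @ [(b, False, \<not> s), (a, False, s)] @ x))
     \<or> (\<exists>u1 u2 u3 u4 c h r i j k. inj_on h {0, 1, 2} \<and> {i, j, k} = {0, 1, 2 :: nat} \<and>
          w = u1 @ r3_seg False c h r i @ u2 @ r3_seg False c h r j @ u3 @ r3_seg False c h r k @ u4 \<and>
          w' = u1 @ r3_seg True c h r i @ u2 @ r3_seg True c h r j @ u3 @ r3_seg True c h r k @ u4))"

definition vk_equiv :: "gcode \<Rightarrow> gcode \<Rightarrow> bool" where
  "vk_equiv = (\<lambda>x y. vk_move x y \<or> vk_move y x)\<^sup>*\<^sup>*"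

definition cc :: "nat \<Rightarrow> gcode \<Rightarrow> gcode" where
  "cc a w = map (\<lambda>(b, ov, s). if b = a then (b, \<not> ov, \<not> s) else (b, ov, s)) w"

fun vk_cc :: "nat \<Rightarrow> gcode \<Rightarrow> gcode \<Rightarrow> bool" where
  "vk_cc 0 w w' = vk_equiv w w'"
| "vk_cc (Suc n) w w' = (\<exists>w1 a. vk_cc n w w1 \<and> vk_equiv (cc a w1) w')"

definition virtually_null_homotopic :: "gcode \<Rightarrow> bool" where
  "virtually_null_homotopic K \<longleftrightarrow> (\<exists>n. vk_cc n K [])"

definition vu :: "gcode \<Rightarrow> nat" where
  "vu K = (LEAST n. vk_cc n K [])"

datatype bgen = Sig nat | Vir nat

fun gen_step :: "nat \<Rightarrow> bgen \<Rightarrow> nat \<Rightarrow> gcode \<times> nat" where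
  "gen_step k (Sig m) pos =
     (if pos = m then ([(k, True, True)], m + 1)
      else if pos = m + 1 then ([(k, False, True)], m) else ([], pos))"
| "gen_step k (Vir m) pos =
     (if pos = m then ([], m + 1) else if pos = m + 1 then ([], m) else ([], pos))"

fun bpass :: "nat \<Rightarrow> bgen list \<Rightarrow> nat \<Rightarrow> gcode \<times> nat" where
  "bpass k [] pos = ([], pos)"
| "bpass k (g # gs) pos =
     (let (l, pos') = gen_step k g pos; (l', pe) = bpass (Suc k) gs pos' in (l @ l', pe))"

fun close_iter :: "bgen list \<Rightarrow> nat \<Rightarrow> nat \<Rightarrow> gcode" where
  "close_iter bw 0 pos = []"
| "close_iter bw (Suc n) pos = (let (l, pe) = bpass 0 bw pos in l @ close_iter bw n pe)"

text \<open>Gauss code of the closure of a p-strand virtual braid whose closure is a knot: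
  start at position 1 and run through the braid p times.\<close>
definition braid_closure :: "bgen list \<Rightarrow> nat \<Rightarrow> gcode" where
  "braid_closure bw p = close_iter bw p 1"

definition VT1_braid :: "nat \<Rightarrow> nat \<Rightarrow> bgen list" where
  "VT1_braid p q = map Vir [1..<p] @ concat (replicate (q - 1) (map Sig [1..<p]))"

definition VT1 :: "nat \<Rightarrow> nat \<Rightarrow> gcode" where
  "VT1 p q = braid_closure (VT1_braid p q) p"

end

(* Give a letter the weight +1 if it is an overcrossing of a positive or an undercrossing of a
   negative crossing, and -1 otherwise. The index of a crossing is the total weight of the arc
   leading from its overpass to its underpass; it is unchanged by all moves, and R1 crossings have
   index 0. Hence, for phi with phi(0) = 0, the sum of sign * phi(index) over all crossings is an
   invariant. A crossing change negates both the sign and the index of its crossing only, so the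
   sum for phi = sgn does not change at all, and the number of crossings of nonzero index, counted
   with sign, changes by at most 2.

   In a braid the weights are the steps between positions at classical crossings, so the index of
   a crossing of VT1 is the difference between the times at which the knot runs through its
   lower and its upper strand. In particular all (p-1)(q-1) crossings are positive and have
   nonzero index, which is the lower bound.

   Changing the crossings of negative index makes the diagram descending from the start of the
   virtual overstrand. For a descending diagram the classical part of the braid may be replaced by
   any other word for the same permutation (R2, R3), and a generator can be carried from its
   beginning to its end around the closure, as long as it avoids the position where the virtual
   overstrand arrives. This conjugation reduces the permutation to the identity, hence the word to
   the empty one. As the diagram is then null-homotopic, the invariant for phi = sgn vanishes,
   so that exactly half of the crossings have been changed. *)

theory Submission
  imports Defs "HOL-Library.Multiset"
begin

section \<open>Indices of crossings\<close>

text \<open>The sign is dropped because a letter of a well-formed code is already determined by its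
  crossing and its level.\<close>

definition key :: "gletter \<Rightarrow> nat \<times> bool" where
  "key l = (fst l, fst (snd l))"

lemma key_simp [simp]: "key (a, ov, s) = (a, ov)"
  by (simp add: key_def)

lemma labels_simps [simp]:
  "labels [] = {}" "labels (l # w) = insert (fst l) (labels w)"
  "labels (u @ v) = labels u \<union> labels v"
  by (auto simp: labels_def)

lemma finite_labels [simp]: "finite (labels w)"
  by (simp add: labels_def)

lemma labels_iff: "a \<in> labels w \<longleftrightarrow> (\<exists>ov s. (a, ov, s) \<in> set w)"
  by (force simp: labels_def)

lemma key_in_labels: "(a, ov) \<in> key ` set w \<Longrightarrow> a \<in> labels w"
  by (force simp: labels_def key_def)

section \<open>Well-formed Gauss codes as multisets of letters\<close>

lemma mset_pair: "mset l = {#x, y#} \<Longrightarrow> l = [x, y] \<or> l = [y, x]"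
proof -
  assume m: "mset l = {#x, y#}"
  have "length l = 2" using arg_cong[OF m, of size] by simp
  then obtain a b where "l = [a, b]" by (auto simp: numeral_2_eq_2 length_Suc_conv)
  with m show ?thesis by (auto simp: add_eq_conv_ex)
qed

text \<open>The order of the letters is irrelevant; in this form well-formedness passes between
  codes with equal multisets.\<close>

lemma gc_wf_mset_iff:
  "gc_wf w \<longleftrightarrow> (\<forall>a \<in> labels w. \<exists>s.
      mset (filter (\<lambda>l. fst l = a) w) = {#(a, True, s), (a, False, s)#})"
proof -
  have "(xs = [x, y] \<or> xs = [y, x]) \<longleftrightarrow> mset xs = {#x, y#}" for xs and x y :: gletter
    using mset_pair[of xs x y] by auto
  then show ?thesis unfolding gc_wf_def by simp
qed

lemma gc_wf_cong_mset:
  assumes "mset w = mset w'"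
  shows "gc_wf w \<longleftrightarrow> gc_wf w'"
proof -
  have "labels w = labels w'" using mset_eq_setD[OF assms] by (simp add: labels_def)
  then show ?thesis unfolding gc_wf_mset_iff using assms by simp
qed

lemma gc_wf_Nil [simp]: "gc_wf []"
  by (simp add: gc_wf_def)

lemma gc_wf_insert:
  assumes "gc_wf w" "k \<notin> labels w"
  shows "gc_wf ((k, True, s) # (k, False, s) # w)"
proof -
  have "filter (\<lambda>l. fst l = k) w = []"
    using assms(2) by (auto simp: labels_def filter_empty_conv)
  then show ?thesis using assms unfolding gc_wf_def by auto
qed

lemma gc_wf_filter:
  assumes "gc_wf w" "a \<in> labels w"
  obtains s where "mset (filter (\<lambda>l. fst l = a) w) = {#(a, True, s), (a, False, s)#}"
  using assms unfolding gc_wf_mset_iff by blast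

lemma gc_wf_keys:
  assumes "gc_wf w" "a \<in> labels w"
  shows "(a, ov) \<in> key ` set w"
proof -
  from assms obtain s where m: "mset (filter (\<lambda>l. fst l = a) w) = {#(a, True, s), (a, False, s)#}"
    by (rule gc_wf_filter)
  have "set (filter (\<lambda>l. fst l = a) w) = {(a, True, s), (a, False, s)}"
    using arg_cong[OF m, of set_mset] by simp
  then have "(a, ov, s) \<in> set w" by (cases ov) auto
  then show ?thesis by force
qed

text \<open>This gives each letter a unique position, so that a height, read off at the first
  matching letter, is the intended one.\<close>

lemma gc_wf_distinct_keys:
  assumes "gc_wf w"
  shows "distinct (map key w)"
proof -
  have "count (mset (map key w)) (a, ov) \<le> 1" for a ov
  proof (cases "a \<in> labels w")
    case True
    then obtain s where m: "mset (filter (\<lambda>l. fst l = a) w) = {#(a, True, s), (a, False, s)#}"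
      using assms gc_wf_filter by blast
    have "filter_mset (\<lambda>x. x = (a, ov)) (mset (map key w))
        = filter_mset (\<lambda>x. x = (a, ov)) (image_mset key (mset (filter (\<lambda>l. fst l = a) w)))"
      by (induction w) (auto simp: key_def)
    also have "\<dots> = {#(a, ov)#}" unfolding m by (cases ov) auto
    finally have "count (filter_mset (\<lambda>x. x = (a, ov)) (mset (map key w))) (a, ov) = 1" by simp
    then show ?thesis by simp
  next
    case False
    then have "(a, ov) \<notin> set (map key w)" using key_in_labels by auto
    then show ?thesis by (metis count_mset_0_iff le0)
  qed
  then have le: "count (mset (map key w)) x \<le> 1" for x
    by (cases x) simp
  have "count (mset (map key w)) x = (if x \<in> set (map key w) then 1 else 0)" for x
  proof -
    have zero: "count (mset (map key w)) x = 0 \<longleftrightarrow> x \<notin> set (map key w)"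
      by (metis not_in_iff set_mset_mset)
    have "n = (if P then 1 else 0)" if "n \<le> 1" "n = 0 \<longleftrightarrow> \<not> P" for n :: nat and P
      using that by auto
    from this[OF le zero] show ?thesis .
  qed
  then show ?thesis
    unfolding distinct_count_atmost_1 by blast
qed

text \<open>The weight of a letter; crossing changes do not affect it.\<close>

definition val :: "gletter \<Rightarrow> int" where
  "val l = (if fst (snd l) = snd (snd l) then 1 else - 1)"

abbreviation tot :: "gcode \<Rightarrow> int" where
  "tot w \<equiv> sum_list (map val w)"

text \<open>\<open>ht w a ov\<close> is the weight of the part of \<open>w\<close> strictly before the given letter. As the total
  weight is 0, the difference of heights in \<open>ind\<close> does not depend on which of the two letters comes
  first; the sign accounts for the overpass itself.\<close>

definition ht :: "gcode \<Rightarrow> nat \<Rightarrow> bool \<Rightarrow> int" where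
  "ht w a ov = tot (takeWhile (\<lambda>l. key l \<noteq> (a, ov)) w)"

definition sg :: "gcode \<Rightarrow> nat \<Rightarrow> int" where
  "sg w a = (if (a, True, True) \<in> set w then 1 else - 1)"

definition ind :: "gcode \<Rightarrow> nat \<Rightarrow> int" where
  "ind w a = ht w a False - ht w a True - sg w a"

definition index_sum :: "(int \<Rightarrow> int) \<Rightarrow> gcode \<Rightarrow> int" where
  "index_sum \<phi> w = (\<Sum>a\<in>labels w. sg w a * \<phi> (ind w a))"

lemma val_simp [simp]: "val (a, ov, s) = (if ov = s then 1 else - 1)"
  by (simp add: val_def)

lemma ht_Nil [simp]: "ht [] a ov = 0"
  by (simp add: ht_def)

lemma ht_Cons: "ht (l # w) a ov = (if key l = (a, ov) then 0 else val l + ht w a ov)"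
  by (simp add: ht_def)

lemma ht_append:
  "ht (u @ v) a ov = (if (a, ov) \<in> key ` set u then ht u a ov else tot u + ht v a ov)"
  by (induction u) (auto simp: ht_Cons)

lemma ht_split:
  assumes "gc_wf (u @ (a, ov, s) # v)"
  shows "ht (u @ (a, ov, s) # v) a ov = tot u"
  using gc_wf_distinct_keys[OF assms] by (auto simp: ht_append ht_Cons)

lemma tot_filter:
  assumes "finite A" "labels w \<subseteq> A"
  shows "tot w = (\<Sum>a\<in>A. tot (filter (\<lambda>l. fst l = a) w))"
  using assms(2)
proof (induction w)
  case Nil
  then show ?case by simp
next
  case (Cons l w)
  have "(\<Sum>a\<in>A. tot (filter (\<lambda>l. fst l = a) (l # w)))
      = (\<Sum>a\<in>A. (if fst l = a then val l else 0) + tot (filter (\<lambda>l. fst l = a) w))"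
    by (intro sum.cong) auto
  also have "\<dots> = val l + tot w"
    using Cons assms(1) by (simp add: sum.distrib)
  finally show ?case by simp
qed

text \<open>The two letters of a crossing share the sign and differ in level, so their weights
  cancel.\<close>

lemma tot_gc_wf:
  assumes "gc_wf w"
  shows "tot w = 0"
proof -
  have "tot (filter (\<lambda>l. fst l = a) w) = 0" if a: "a \<in> labels w" for a
  proof -
    obtain s where m: "mset (filter (\<lambda>l. fst l = a) w) = {#(a, True, s), (a, False, s)#}"
      using assms a gc_wf_filter by blast
    have "tot (filter (\<lambda>l. fst l = a) w) = sum_mset (image_mset val (mset (filter (\<lambda>l. fst l = a) w)))"
      by (simp flip: sum_mset_sum_list)
    then show ?thesis unfolding m by simp
  qed
  then show ?thesis using tot_filter[of "labels w" w] by simp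
qed

section \<open>Rotation, relabelling, R1 and R2\<close>

lemma index_sum_cong:
  assumes "labels w = labels w'"
    and "\<And>a. a \<in> labels w \<Longrightarrow> sg w a = sg w' a"
    and "\<And>a. a \<in> labels w \<Longrightarrow> ht w a False - ht w a True = ht w' a False - ht w' a True"
  shows "index_sum \<phi> w = index_sum \<phi> w'"
  unfolding index_sum_def ind_def using assms by simp

text \<open>Every height drops by the weight of the letter taken from the front. The moved letter
  goes from height 0 to \<open>tot v = - val l\<close>, the same drop, so differences of heights
  survive.\<close>

lemma index_sum_rotate1:
  assumes "gc_wf w"
  shows "index_sum \<phi> (rotate1 w) = index_sum \<phi> w"
proof (cases w)
  case (Cons l v)
  have t: "tot v = - val l" using tot_gc_wf[OF assms] Cons by simp
  have "ht (v @ [l]) a ov = ht (l # v) a ov - val l" if "a \<in> labels w" for a ov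
  proof (cases "key l = (a, ov)")
    case True
    have "key l \<notin> key ` set v" using gc_wf_distinct_keys[OF assms] Cons by simp
    then show ?thesis using True t by (simp add: ht_Cons ht_append)
  next
    case False
    then have "(a, ov) \<in> key ` set v"
      using gc_wf_keys[OF assms that, of ov] Cons by auto
    then show ?thesis using False by (simp add: ht_Cons ht_append)
  qed
  then show ?thesis
    by (intro index_sum_cong) (auto simp: Cons sg_def)
qed simp

lemma ht_relabel:
  assumes "inj_on f A" "labels w \<subseteq> A" "a \<in> A"
  shows "ht (map (\<lambda>(a, ov, s). (f a, ov, s)) w) (f a) ov = ht w a ov"
  using assms(2)
proof (induction w)
  case (Cons l w)
  obtain b o' s where l: "l = (b, o', s)" by (cases l)
  have "f b = f a \<longleftrightarrow> b = a" using assms Cons.prems l by (auto simp: inj_on_def)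
  then show ?case using Cons by (simp add: ht_Cons l)
qed simp

lemma index_sum_relabel:
  assumes f: "inj_on f (labels w)"
  shows "index_sum \<phi> (map (\<lambda>(a, ov, s). (f a, ov, s)) w) = index_sum \<phi> w" (is "index_sum \<phi> ?w' = _")
proof -
  have lab: "labels ?w' = f ` labels w" by (force simp: labels_def image_image split: prod.splits)
  have sg: "sg ?w' (f a) = sg w a" if "a \<in> labels w" for a
  proof -
    have "(f a, True, True) \<in> set ?w' \<longleftrightarrow> (a, True, True) \<in> set w"
    proof
      assume "(f a, True, True) \<in> set ?w'"
      then obtain b where b: "(b, True, True) \<in> set w" "f b = f a" by auto
      then have "b \<in> labels w" by (force simp: labels_def)
      then show "(a, True, True) \<in> set w" using f that b by (auto simp: inj_on_def)
    qed force
    then show ?thesis by (simp add: sg_def)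
  qed
  have ind: "ind ?w' (f a) = ind w a" if "a \<in> labels w" for a
    unfolding ind_def ht_relabel[OF f order_refl that] sg[OF that] ..
  show ?thesis
    unfolding index_sum_def lab sum.reindex[OF f] comp_def
    by (rule sum.cong) (simp_all only: sg ind)
qed

text \<open>The two adjacent letters have opposite weights, so no other height changes, and the new
  crossing has index 0; hence the condition on \<open>\<phi>\<close>.\<close>

lemma index_sum_R1:
  assumes wf: "gc_wf (u @ [(a, ov, s), (a, \<not> ov, s)] @ v)" and \<phi>: "\<phi> 0 = 0"
  shows "index_sum \<phi> (u @ [(a, ov, s), (a, \<not> ov, s)] @ v) = index_sum \<phi> (u @ v)"
    (is "index_sum \<phi> ?w' = index_sum \<phi> ?w")
proof -
  have nk: "(a, x) \<notin> key ` set u" "(a, x) \<notin> key ` set v" for x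
    using gc_wf_distinct_keys[OF wf] by (cases x; cases ov; auto)+
  have na: "a \<notin> labels ?w"
    using nk by (force simp: labels_iff image_iff)
  have ht: "ht ?w' b x = ht ?w b x" if "b \<noteq> a" for b x
    using that by (auto simp: ht_append ht_Cons)
  have sg: "sg ?w' b = sg ?w b" if "b \<noteq> a" for b
    using that by (auto simp: sg_def)
  have "ind ?w' a = 0"
    using nk[of True] nk[of False] na
    by (cases ov; cases s) (auto simp: ind_def sg_def ht_append ht_Cons labels_iff)
  then have "index_sum \<phi> ?w' = (\<Sum>b\<in>labels ?w. sg ?w' b * \<phi> (ind ?w' b))"
    using na \<phi> by (simp add: index_sum_def)
  also have "\<dots> = index_sum \<phi> ?w"
    unfolding index_sum_def ind_def using na by (intro sum.cong refl) (metis ht sg)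
  finally show ?thesis .
qed

text \<open>Each inserted pair of letters has total weight 0, so the old heights persist. The new
  crossings have equal indices and opposite signs, and their terms cancel for every
  \<open>\<phi>\<close>.\<close>

lemma index_sum_R2:
  assumes wf: "gc_wf w'"
    and w: "w = u @ v @ x"
    and w': "w' = u @ [(a, True, s), (b, True, \<not> s)] @ v @ [(a, False, s), (b, False, \<not> s)] @ x \<or>
             w' = u @ [(a, True, s), (b, True, \<not> s)] @ v @ [(b, False, \<not> s), (a, False, s)] @ x"
  shows "index_sum \<phi> w' = index_sum \<phi> w"
proof -
  note d = gc_wf_distinct_keys[OF wf]
  have ab: "a \<noteq> b" using d w' by auto
  have nk: "(c, y) \<notin> key ` set w" if "c \<in> {a, b}" for c y
  proof -
    have "c = a \<or> c = b" using that by blast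
    then show ?thesis using d w' unfolding w
      by (cases y; elim disjE; simp add: image_Un)
  qed
  have na: "c \<notin> labels w" if "c \<in> {a, b}" for c
    using nk[OF that] by (force simp: labels_iff image_iff)
  have lab: "labels w' = insert a (insert b (labels w))" using w w' by auto
  have ht: "ht w' c y = ht w c y" if "c \<noteq> a" "c \<noteq> b" for c y
    using that w' unfolding w by (elim disjE) (simp_all add: ht_append ht_Cons image_Un)
  have sg: "sg w' c = sg w c" if "c \<noteq> a" "c \<noteq> b" for c
    using that w w' by (auto simp: sg_def)
  have n: "(a, True, True) \<notin> set w" "(b, True, True) \<notin> set w"
    using na[of a] na[of b] by (auto simp: labels_iff)
  have sab: "sg w' a = - sg w' b"
    using w w' ab n by (cases s) (auto simp: sg_def)
  have ht_ab: "(c, y) \<notin> key ` set u" "(c, y) \<notin> key ` set v" "(c, y) \<notin> key ` set x"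
    if "c \<in> {a, b}" for c y
    using nk[OF that, of y] w by auto
  have "sg w' a = (if s then 1 else - 1)"
    using w w' ab n by (cases s) (auto simp: sg_def)
  with w' ab sab have iab: "ind w' a = ind w' b"
    by (elim disjE; cases s) (simp_all add: ind_def ht_append ht_Cons ht_ab)
  have "index_sum \<phi> w' = (\<Sum>c\<in>labels w. sg w' c * \<phi> (ind w' c))"
    using na ab by (simp add: index_sum_def lab sab iab)
  also have "\<dots> = index_sum \<phi> w"
    proof (unfold index_sum_def ind_def, rule sum.cong)
    fix c assume "c \<in> labels w"
    with na[of a] na[of b] have "c \<noteq> a" "c \<noteq> b" by auto
    then show "sg w' c * \<phi> (ht w' c False - ht w' c True - sg w' c)
        = sg w c * \<phi> (ht w c False - ht w c True - sg w c)"
      by (simp add: ht sg)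
  qed simp
  finally show ?thesis .
qed

section \<open>Invariance under the moves\<close>

lemma three_cases:
  assumes "{x, y, z} = {0, 1, 2 :: nat}"
  shows "(x, y, z) \<in> {(0,1,2), (0,2,1), (1,0,2), (1,2,0), (2,0,1), (2,1,0)}"
proof -
  have "x \<in> {0, 1, 2}" "y \<in> {0, 1, 2}" "z \<in> {0, 1, 2}"
    "0 \<in> {x, y, z}" "1 \<in> {x, y, z}" "2 \<in> {x, y, z}"
    using assms by blast+
  then show ?thesis by (simp only: insert_iff empty_iff prod.inject) presburger
qed

text \<open>Level and sign both flip with the heights, so the weight depends only on the oriented
  plane picture.\<close>

lemma val_r3_letter:
  assumes "h x \<noteq> h y" "x \<noteq> y"
  shows "val (r3_letter c h r x y) = (if (x < y) \<noteq> (r x \<noteq> r y) then 1 else - 1)"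
  using assms by (auto simp: r3_letter_def min_def max_def)

lemma key_r3_letter: "key (r3_letter c h r x y) = (c (min x y) (max x y), h y < h x)"
  by (simp add: r3_letter_def)

text \<open>Symmetric in the roles of \<open>y\<close> and \<open>z\<close>, so that either crossing
  of strand \<open>x\<close> can be singled out.\<close>

lemma r3_seg_alt:
  assumes "{x, y, z} = {0, 1, 2}"
  shows "r3_seg side c h r x =
    (if (y < z) \<noteq> (side \<noteq> r x) then [r3_letter c h r x y, r3_letter c h r x z]
     else [r3_letter c h r x z, r3_letter c h r x y])"
proof -
  have "(x, y, z) \<in> {(0,1,2), (0,2,1), (1,0,2), (1,2,0), (2,0,1), (2,1,0)}"
    using assms by (rule three_cases)
  then show ?thesis
    by (elim insertE emptyE) (simp_all add: r3_seg_def r3_others_def Let_def)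
qed

lemma r3_seg_mset: "mset (r3_seg side c h r x) = mset (r3_seg side' c h r x)"
  by (simp add: r3_seg_def Let_def split: prod.split)

lemma r3_seg_tot: "tot (r3_seg True c h r x) = tot (r3_seg False c h r x)"
  by (simp add: r3_seg_def Let_def split: prod.split)

text \<open>The change of height depends only on the third strand \<open>z\<close>, so it is the same for both letters
  of the crossing of \<open>x\<close> and \<open>y\<close>.\<close>

lemma r3_ht_shift:
  assumes xyz: "{x, y, z} = {0, 1, 2}" and h: "inj_on h {0, 1, 2}"
    and w: "gc_wf w" "w = A @ r3_seg False c h r x @ B"
    and w': "gc_wf w'" "w' = A' @ r3_seg True c h r x @ B'"
    and tot: "tot A' = tot A"
  shows "ht w' (c (min x y) (max x y)) (h y < h x)
       = ht w (c (min x y) (max x y)) (h y < h x) + (if (z = 1) = r z then 1 else - 1)"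
proof -
  let ?l = "r3_letter c h r x y" and ?l' = "r3_letter c h r x z"
  have cases: "(x, y, z) \<in> {(0,1,2), (0,2,1), (1,0,2), (1,2,0), (2,0,1), (2,1,0)}"
    using xyz by (rule three_cases)
  have ne: "h x \<noteq> h z" "x \<noteq> z" using h cases by (auto simp: inj_on_def)
  note d = gc_wf_distinct_keys[OF w(1)] gc_wf_distinct_keys[OF w'(1)]
  have seg: "set (r3_seg side c h r x) = {?l, ?l'}" for side
    by (simp add: r3_seg_alt[OF xyz] insert_commute)
  have k: "key ?l \<notin> key ` set A" "key ?l \<notin> key ` set A'" 
    using d seg unfolding w w' by (auto simp: image_Un)
  have k': "key ?l' \<noteq> key ?l"
    using d(1) unfolding w r3_seg_alt[OF xyz] by (auto split: if_splits)
  have "ht w' (c (min x y) (max x y)) (h y < h x) =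
      tot A + (if (y < z) \<noteq> (True \<noteq> r x) then 0 else val ?l')"
    using k k' unfolding w' r3_seg_alt[OF xyz] key_r3_letter
    by (auto simp: ht_append ht_Cons key_r3_letter tot)
  moreover have "ht w (c (min x y) (max x y)) (h y < h x) =
      tot A + (if (y < z) \<noteq> r x then 0 else val ?l')"
    using k k' unfolding w r3_seg_alt[OF xyz] key_r3_letter
    by (auto simp: ht_append ht_Cons key_r3_letter)
  \<comment> \<open>The sides of the move differ in whether \<open>x\<close> meets \<open>z\<close>
    before \<open>y\<close>, so the weight of the crossing with \<open>z\<close> is gained or
    lost.\<close>
  moreover have "(if (y < z) \<noteq> (True \<noteq> r x) then 0 else val ?l')
      = (if (y < z) \<noteq> r x then 0 else val ?l') + (if (z = 1) = r z then 1 else - 1)"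
    unfolding val_r3_letter[OF ne] using cases
    by (elim insertE emptyE; cases "r x"; cases "r z") simp_all
  ultimately show ?thesis by simp
qed

text \<open>The segments keep their letters and weights, so only heights inside them can change;
  there \<open>r3_ht_shift\<close> applies to both letters of a crossing, with the same third
  strand.\<close>

lemma index_sum_R3:
  assumes h: "inj_on h {0, 1, 2}" and ijk: "{i, j, k} = {0, 1, 2 :: nat}"
    and wf: "gc_wf w" "gc_wf w'"
    and w: "w = u1 @ r3_seg False c h r i @ u2 @ r3_seg False c h r j @ u3 @ r3_seg False c h r k @ u4"
    and w': "w' = u1 @ r3_seg True c h r i @ u2 @ r3_seg True c h r j @ u3 @ r3_seg True c h r k @ u4"
  shows "index_sum \<phi> w' = index_sum \<phi> w"
proof (rule index_sum_cong)
  have sets: "set w' = set w"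
    using mset_eq_setD[OF r3_seg_mset, of True c h r _ False] by (simp add: w w')
  then show "labels w' = labels w" by (simp add: labels_def)
  show "sg w' a = sg w a" for a by (simp add: sg_def sets)
  fix a
  show "ht w' a False - ht w' a True = ht w a False - ht w a True"
  proof (cases "\<exists>x\<in>{0, 1, 2}. \<exists>y\<in>{0, 1, 2}. x \<noteq> y \<and> a = c (min x y) (max x y)")
    case True
    then obtain x y where xy: "x \<in> {0, 1, 2}" "y \<in> {0, 1, 2}" "x \<noteq> y"
      and a: "a = c (min x y) (max x y)" by blast
    \<comment> \<open>The third strand, as 0 + 1 + 2 = 3.\<close>
    define z where "z = 3 - x - y"
    have z: "{x, y, z} = {0, 1, 2}" "{y, x, z} = {0, 1, 2}"
      using xy by (auto simp: z_def)
    have dec: "\<exists>A B A' B'. w = A @ r3_seg False c h r t @ B \<and> w' = A' @ r3_seg True c h r t @ B'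
        \<and> tot A' = tot A" if "t \<in> {0, 1, 2}" for t
    proof -
      have "t = i \<or> t = j \<or> t = k" using that ijk by blast
      then show ?thesis
      proof (elim disjE)
        assume "t = i"
        then show ?thesis unfolding w w' by blast
      next
        assume "t = j"
        have "w = (u1 @ r3_seg False c h r i @ u2) @ r3_seg False c h r j @ (u3 @ r3_seg False c h r k @ u4)"
          "w' = (u1 @ r3_seg True c h r i @ u2) @ r3_seg True c h r j @ (u3 @ r3_seg True c h r k @ u4)"
          by (simp_all add: w w')
        moreover have "tot (u1 @ r3_seg True c h r i @ u2) = tot (u1 @ r3_seg False c h r i @ u2)"
          by (simp add: r3_seg_tot)
        ultimately show ?thesis unfolding \<open>t = j\<close> by blast
      next
        assume "t = k"
        have "w = (u1 @ r3_seg False c h r i @ u2 @ r3_seg False c h r j @ u3) @ r3_seg False c h r k @ u4"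
          "w' = (u1 @ r3_seg True c h r i @ u2 @ r3_seg True c h r j @ u3) @ r3_seg True c h r k @ u4"
          by (simp_all add: w w')
        moreover have "tot (u1 @ r3_seg True c h r i @ u2 @ r3_seg True c h r j @ u3)
          = tot (u1 @ r3_seg False c h r i @ u2 @ r3_seg False c h r j @ u3)"
          by (simp add: r3_seg_tot)
        ultimately show ?thesis unfolding \<open>t = k\<close> by blast
      qed
    qed
    have 1: "ht w' a (h y < h x) = ht w a (h y < h x) + (if (z = 1) = r z then 1 else - 1)"
      using dec[OF xy(1)] r3_ht_shift[OF z(1) h wf(1) _ wf(2)] a by metis
    have 2: "ht w' a (h x < h y) = ht w a (h x < h y) + (if (z = 1) = r z then 1 else - 1)"
      using dec[OF xy(2)] r3_ht_shift[OF z(2) h wf(1) _ wf(2)] a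
      by (metis min.commute max.commute)
    have "h x \<noteq> h y" using h xy by (auto simp: inj_on_def)
    then have "(h y < h x) = (\<not> h x < h y)" by linarith
    with 1 2 show ?thesis by (cases "h x < h y") simp_all
  next
    case False
    have N: "a \<noteq> c (min x y) (max x y)" if "x \<in> {0, 1, 2}" "y \<in> {0, 1, 2}" "x \<noteq> y" for x y
    proof
      assume "a = c (min x y) (max x y)"
      with that(3) have "x \<noteq> y \<and> a = c (min x y) (max x y)" ..
      then have "\<exists>x\<in>{0, 1, 2}. \<exists>y\<in>{0, 1, 2}. x \<noteq> y \<and> a = c (min x y) (max x y)"
        using that(1,2) by (intro bexI)
      with False show False by contradiction
    qed
    have nk: "(a, ov) \<notin> key ` set (r3_seg side c h r t)" if t: "t \<in> {0, 1, 2}" for ov side t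
    proof -
      obtain y z where yz: "{t, y, z} = {0, 1, 2}" "y \<noteq> t" "z \<noteq> t" "y \<in> {0,1,2}" "z \<in> {0,1,2}"
      proof -
        from t consider "t = 0" | "t = 1" | "t = 2" by blast
        then show thesis
          using that[of 1 2] that[of 0 2] that[of 0 1] by cases (simp_all add: insert_commute)
      qed
      have "c (min t y) (max t y) \<noteq> a" "c (min t z) (max t z) \<noteq> a"
        using N[OF t yz(4) yz(2)[symmetric]] N[OF t yz(5) yz(3)[symmetric]] by simp_all
      then show ?thesis
        unfolding r3_seg_alt[OF yz(1)] by (simp add: key_r3_letter)
    qed
    have "i \<in> {0, 1, 2}" "j \<in> {0, 1, 2}" "k \<in> {0, 1, 2}" using ijk by blast+
    note nk = this[THEN nk]
    have "ht w' a ov = ht w a ov" for ov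
      unfolding w w' by (simp only: ht_append r3_seg_tot map_append sum_list_append nk if_False)
    then show ?thesis by simp
  qed
qed

lemma index_sum_vk_move:
  assumes "vk_move w w'" and \<phi>: "\<phi> 0 = 0"
  shows "index_sum \<phi> w' = index_sum \<phi> w"
proof -
  have wf: "gc_wf w" "gc_wf w'" using assms(1) by (auto simp: vk_move_def)
  from assms(1)[unfolded vk_move_def] show ?thesis
  proof (elim conjE disjE exE, goal_cases)
    case 1
    then show ?case by (simp add: index_sum_rotate1)
  next
    case (2 f)
    then show ?case by (simp only: index_sum_relabel)
  next
    case (3 u v a ov s)
    then show ?case using index_sum_R1[where \<phi> = \<phi>, OF _ \<phi>] wf by metis
  next
    case (4 u v x a b s)
    then show ?case using index_sum_R2[OF wf(2)] by blast
  next
    case (5 u v x a b s)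
    then show ?case using index_sum_R2[OF wf(2)] by blast
  next
    case (6 u1 u2 u3 u4 c h r i j k)
    then show ?case by (intro index_sum_R3[OF _ _ wf]) 
  qed
qed

section \<open>Equivalence of codes\<close>

lemma vk_equiv_induct_invariant:
  assumes "vk_equiv w w'" "\<And>u v. vk_move u v \<Longrightarrow> f v = f u"
  shows "f w' = f w"
  using assms(1) unfolding vk_equiv_def
  by (induction rule: rtranclp_induct) (use assms(2) in auto)

lemma vk_equiv_gc_wf:
  assumes "vk_equiv w w'"
  shows "gc_wf w' = gc_wf w"
  by (rule vk_equiv_induct_invariant[OF assms]) (auto simp: vk_move_def)

lemma vk_equiv_index_sum:
  assumes "vk_equiv w w'" "\<phi> 0 = 0"
  shows "index_sum \<phi> w' = index_sum \<phi> w"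
  by (rule vk_equiv_induct_invariant[where f = "index_sum \<phi>", OF assms(1)])
    (rule index_sum_vk_move[where \<phi> = \<phi>, OF _ assms(2)])

lemma vk_equiv_refl [simp]: "vk_equiv w w"
  by (simp add: vk_equiv_def)

lemma vk_equiv_trans [trans]: "vk_equiv u v \<Longrightarrow> vk_equiv v w \<Longrightarrow> vk_equiv u w"
  unfolding vk_equiv_def by simp

lemma vk_equiv_sym: "vk_equiv u v \<Longrightarrow> vk_equiv v u"
  unfolding vk_equiv_def
  by (induction rule: rtranclp_induct) (auto intro: converse_rtranclp_into_rtranclp)

lemma vk_equiv_move: "vk_move u v \<Longrightarrow> vk_equiv u v"
  unfolding vk_equiv_def by blast

section \<open>Crossing changes\<close>

lemma labels_cc [simp]: "labels (cc a w) = labels w"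
  by (force simp: cc_def labels_def image_image split: prod.splits if_splits)

text \<open>Flipping level and sign together preserves weights, so only the two letters of
  \<open>a\<close> trade places.\<close>

lemma ht_cc: "ht (cc a w) b ov = ht w b (if b = a then \<not> ov else ov)"
proof (induction w)
  case (Cons l w)
  have "ht (cc a (l # w)) b ov =
    ht ((case l of (b, ov, s) \<Rightarrow> if b = a then (b, \<not> ov, \<not> s) else (b, ov, s)) # cc a w) b ov"
    by (simp add: cc_def)
  then show ?case using Cons by (cases l) (auto simp: ht_Cons)
qed (simp add: cc_def)

lemma set_cc: "(b, ov, s) \<in> set (cc a w) \<longleftrightarrow> (b, ov \<noteq> (b = a), s \<noteq> (b = a)) \<in> set w"
  by (force simp: cc_def split: if_splits)

lemma gc_wf_cc:
  assumes "gc_wf w"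
  shows "gc_wf (cc a w)"
proof -
  let ?g = "\<lambda>(b, ov, s). if b = a then (b, \<not> ov, \<not> s) else (b, ov, s)"
  have f: "filter (\<lambda>l. fst l = b) (cc a w) = map ?g (filter (\<lambda>l. fst l = b) w)" for b
    by (induction w) (auto simp: cc_def split: if_splits)
  show ?thesis unfolding gc_wf_def labels_cc f
  proof
    fix b assume "b \<in> labels w"
    with assms obtain s where "filter (\<lambda>l. fst l = b) w = [(b, True, s), (b, False, s)] \<or>
      filter (\<lambda>l. fst l = b) w = [(b, False, s), (b, True, s)]" unfolding gc_wf_def by blast
    then show "\<exists>s. map ?g (filter (\<lambda>l. fst l = b) w) = [(b, True, s), (b, False, s)] \<or>
      map ?g (filter (\<lambda>l. fst l = b) w) = [(b, False, s), (b, True, s)]"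
      by (intro exI[of _ "if b = a then \<not> s else s"]) auto
  qed
qed

text \<open>After the change the overpass is the former underpass; that both carried the same sign
  is where well-formedness enters.\<close>

lemma sg_cc:
  assumes "gc_wf w" "b \<in> labels w"
  shows "sg (cc a w) b = (if b = a then - sg w b else sg w b)"
proof (cases "b = a")
  case True
  from assms obtain s where m: "mset (filter (\<lambda>l. fst l = b) w) = {#(b, True, s), (b, False, s)#}"
    by (rule gc_wf_filter)
  have e: "set (filter (\<lambda>l. fst l = b) w) = {(b, True, s), (b, False, s)}"
    using arg_cong[OF m, of set_mset] by simp
  have "(b, x, y) \<in> set w \<longleftrightarrow> y = s" for x y
  proof -
    have "(b, x, y) \<in> set w \<longleftrightarrow> (b, x, y) \<in> set (filter (\<lambda>l. fst l = b) w)" by simp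
    then show ?thesis unfolding e by auto
  qed
  then show ?thesis using True by (simp add: sg_def set_cc)
qed (simp add: sg_def set_cc)

lemma ind_cc:
  assumes "gc_wf w" "b \<in> labels w"
  shows "ind (cc a w) b = (if b = a then - ind w b else ind w b)"
  by (simp add: ind_def ht_cc sg_cc[OF assms])

lemma index_sum_cc:
  assumes wf: "gc_wf w" and a: "a \<in> labels w"
  shows "index_sum \<phi> (cc a w) = index_sum \<phi> w - sg w a * (\<phi> (ind w a) + \<phi> (- ind w a))"
proof -
  have "index_sum \<phi> (cc a w) = (\<Sum>b\<in>labels w. sg w b * \<phi> (ind w b)
      - (if b = a then sg w a * (\<phi> (ind w a) + \<phi> (- ind w a)) else 0))"
    unfolding index_sum_def labels_cc
    by (rule sum.cong) (auto simp: sg_cc[OF wf] ind_cc[OF wf] algebra_simps)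
  also have "\<dots> = index_sum \<phi> w - sg w a * (\<phi> (ind w a) + \<phi> (- ind w a))"
    using a by (simp add: sum_subtractf index_sum_def)
  finally show ?thesis .
qed

text \<open>\<open>vk_cc\<close> accepts any number as a crossing label; one that does not occur
  gives an empty change, which still counts.\<close>

lemma cc_not_label: "a \<notin> labels w \<Longrightarrow> cc a w = w"
  unfolding cc_def by (rule map_idI) (force simp: labels_def)

text \<open>Changing a crossing of index \<open>i\<close> costs
  \<open>\<phi> i + \<phi> (- i)\<close> up to sign: this is 0 for the odd function
  \<open>sgn\<close> and at most 2 for the indicator of the nonzero integers.\<close>

lemma vk_cc_invariant:
  assumes "vk_cc n w w'" "gc_wf w"
  shows "gc_wf w' \<and> index_sum sgn w' = index_sum sgn w \<and>
    \<bar>index_sum (\<lambda>i. if i = 0 then 0 else 1) w' - index_sum (\<lambda>i. if i = 0 then 0 else 1) w\<bar> \<le> 2 * int n"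
  using assms(1)
proof (induction n arbitrary: w')
  case 0
  then have "vk_equiv w w'" by simp
  then show ?case
    using vk_equiv_gc_wf[of w w'] assms(2)
      vk_equiv_index_sum[of w w' sgn] vk_equiv_index_sum[of w w' "\<lambda>i. if i = 0 then 0 else 1"]
    by simp
next
  case (Suc n)
  let ?\<phi> = "\<lambda>i::int. if i = 0 then 0 else 1 :: int"
  from Suc.prems obtain w1 a where w1: "vk_cc n w w1" and eq: "vk_equiv (cc a w1) w'" by auto
  note IH = Suc.IH[OF w1]
  then have wf: "gc_wf w1" by blast
  have "index_sum sgn (cc a w1) = index_sum sgn w1"
    using index_sum_cc[OF wf, of a sgn] cc_not_label[of a w1]
    by (cases "a \<in> labels w1") (auto simp: sgn_minus)
  moreover have "\<bar>index_sum ?\<phi> (cc a w1) - index_sum ?\<phi> w1\<bar> \<le> 2"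
    using index_sum_cc[OF wf, of a ?\<phi>] cc_not_label[of a w1]
    by (cases "a \<in> labels w1") (auto simp: sg_def)
  moreover have "gc_wf w'" using vk_equiv_gc_wf[OF eq] gc_wf_cc[OF wf] by simp
  moreover have "index_sum sgn w' = index_sum sgn (cc a w1)" 
    by (rule vk_equiv_index_sum[OF eq]) simp
  moreover have "index_sum ?\<phi> w' = index_sum ?\<phi> (cc a w1)"
    by (rule vk_equiv_index_sum[OF eq]) simp
  ultimately show ?case using IH by auto
qed

section \<open>Gauss codes of braids with layered crossings\<close>

text \<open>\<open>L\<close> sends positions to strand numbers; then \<open>fold swp ms L\<close>
  tells which strand sits at each position after the word \<open>ms\<close>.\<close>

definition swp :: "nat \<Rightarrow> (nat \<Rightarrow> nat) \<Rightarrow> nat \<Rightarrow> nat" where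
  "swp m L = L(m := L (Suc m), Suc m := L m)"

text \<open>A numbering maps each position to the time at which the closed braid runs through the strand
  at this position.\<close>

abbreviation numbering :: "nat \<Rightarrow> (nat \<Rightarrow> nat) \<Rightarrow> bool" where
  "numbering p L \<equiv> bij_betw L {1..p} {0..<p}"

lemma swp_simps [simp]:
  "swp m L m = L (Suc m)" "swp m L (Suc m) = L m"
  "x \<noteq> m \<Longrightarrow> x \<noteq> Suc m \<Longrightarrow> swp m L x = L x"
  by (simp_all add: swp_def)

lemma swp_swp [simp]: "swp m (swp m L) = L"
  by (auto simp: swp_def)

lemma numbering_swp:
  assumes "numbering p L" "m \<in> {1..<p}"
  shows "numbering p (swp m L)"
proof -
  let ?t = "\<lambda>x. if x = m then Suc m else if x = Suc m then m else x"
  have "bij_betw ?t {1..p} {1..p}"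
    using assms(2) by (intro bij_betw_byWitness[where f' = ?t]) auto
  then have "bij_betw (L \<circ> ?t) {1..p} {0..<p}"
    using assms(1) by (rule bij_betw_trans)
  moreover have "L \<circ> ?t = swp m L" by (auto simp: swp_def)
  ultimately show ?thesis by simp
qed

lemma numbering_fold:
  assumes "numbering p L" "set ms \<subseteq> {1..<p}"
  shows "numbering p (fold swp ms L)"
  using assms
proof (induction ms arbitrary: L)
  case (Cons m ms)
  then show ?case using Cons.IH[OF numbering_swp[OF Cons.prems(1)]] by simp
qed simp

lemma numbering_neq:
  assumes "numbering p L" "m \<in> {1..<p}"
  shows "L m \<noteq> L (Suc m)"
  using inj_on_eq_iff[OF bij_betw_imp_inj_on[OF assms(1)], of m "Suc m"] assms(2) by simp

lemma numbering_less:
  assumes "numbering p L" "x \<in> {1..p}"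
  shows "L x < p"
  using bij_betwE[OF assms(1)] assms(2) by simp

lemma numbering_eq_iff:
  assumes "numbering p L" "x \<in> {1..p}" "y \<in> {1..p}"
  shows "L x = L y \<longleftrightarrow> x = y"
  using inj_on_eq_iff[OF bij_betw_imp_inj_on[OF assms(1)]] assms(2,3) by simp

lemma numbering_obtain:
  assumes "numbering p L" "t < p"
  obtains x where "x \<in> {1..p}" "L x = t"
proof -
  have "t \<in> L ` {1..p}" using assms by (simp add: bij_betw_def)
  then obtain x where "x \<in> {1..p}" "t = L x" ..
  with that show ?thesis by simp
qed

text \<open>The letters met by the strand with number \<open>t\<close>, for a list of pairs of a crossing label and
  the upper position of the crossing. The strand leaving the upper position passes over the other
  one iff their numbers are related by \<open>P\<close>: for the constant \<open>True\<close> this is the given positive braid,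
  for \<open>(<)\<close> its descending version.\<close>

fun strand :: "(nat \<Rightarrow> nat \<Rightarrow> bool) \<Rightarrow> (nat \<times> nat) list \<Rightarrow> (nat \<Rightarrow> nat) \<Rightarrow> nat \<Rightarrow> gcode" where
  "strand P [] L t = []"
| "strand P ((k, m) # ms) L t =
     (let g = P (L m) (L (Suc m)) in
      if L m = t then [(k, g, g)] else if L (Suc m) = t then [(k, \<not> g, g)] else [])
     @ strand P ms (swp m L) t"

text \<open>The virtual block contributes no letters; it enters only through the choice of
  \<open>L\<close>, which fixes the order in which the strands are joined.\<close>

definition code :: "(nat \<Rightarrow> nat \<Rightarrow> bool) \<Rightarrow> nat \<Rightarrow> (nat \<times> nat) list \<Rightarrow> (nat \<Rightarrow> nat) \<Rightarrow> gcode" where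
  "code P p ms L = concat (map (strand P ms L) [0..<p])"

lemma strand_append:
  "strand P (u @ v) L t = strand P u L t @ strand P v (fold swp (map snd u) L) t"
  by (induction u arbitrary: L) auto

lemma strand_append3:
  "strand P (u @ x @ v) L t = strand P u L t @ strand P x (fold swp (map snd u) L) t
    @ strand P v (fold swp (map snd x) (fold swp (map snd u) L)) t"
  by (simp add: strand_append)

lemma mset_code: "mset (code P p ms L) = (\<Sum>t\<in>{0..<p}. mset (strand P ms L t))"
  by (simp add: code_def mset_concat comp_def interv_sum_list_conv_sum_set_nat)

lemma mset_code_Cons:
  assumes "numbering p L" "m \<in> {1..<p}"
  shows "mset (code P p ((k, m) # ms) L) =
    {#(k, P (L m) (L (Suc m)), P (L m) (L (Suc m))), (k, \<not> P (L m) (L (Suc m)), P (L m) (L (Suc m)))#}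
    + mset (code P p ms (swp m L))"
proof -
  let ?g = "P (L m) (L (Suc m))"
  have "L m < p" "L (Suc m) < p"
    using numbering_less[OF assms(1), of m] numbering_less[OF assms(1), of "Suc m"] assms(2) by auto
  moreover have "L m \<noteq> L (Suc m)" using assms by (rule numbering_neq)
  ultimately have "(\<Sum>t\<in>{0..<p}. (if t = L m then {#(k, ?g, ?g)#} else {#})
      + ((if t = L (Suc m) then {#(k, \<not> ?g, ?g)#} else {#}) + mset (strand P ms (swp m L) t)))
      = {#(k, ?g, ?g)#} + ({#(k, \<not> ?g, ?g)#} + mset (code P p ms (swp m L)))"
    unfolding sum.distrib mset_code by simp
  moreover have "mset (strand P ((k, m) # ms) L t) = (if t = L m then {#(k, ?g, ?g)#} else {#})
      + ((if t = L (Suc m) then {#(k, \<not> ?g, ?g)#} else {#}) + mset (strand P ms (swp m L) t))" for t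
    using \<open>L m \<noteq> L (Suc m)\<close> by (simp add: Let_def)
  ultimately show ?thesis by (simp only: mset_code[of P p "(k, m) # ms"]) simp
qed

text \<open>Peeling off the first crossing removes exactly its two letters, up to order, so the
  induction runs on multisets.\<close>

lemma code_wf_labels:
  assumes "numbering p L" "distinct (map fst ms)" "set (map snd ms) \<subseteq> {1..<p}"
  shows "gc_wf (code P p ms L) \<and> labels (code P p ms L) = fst ` set ms"
  using assms
proof (induction ms arbitrary: L)
  case Nil
  have "code P p [] L = []" by (induction p) (auto simp: code_def)
  then show ?case by simp
next
  case (Cons km ms)
  obtain k m where km: "km = (k, m)" by (cases km)
  have m: "m \<in> {1..<p}" using Cons.prems km by simp
  have IH: "gc_wf (code P p ms (swp m L))" "labels (code P p ms (swp m L)) = fst ` set ms"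
    using Cons.IH[of "swp m L"] Cons.prems numbering_swp[OF Cons.prems(1) m] by auto
  let ?g = "P (L m) (L (Suc m))"
  let ?w = "(k, True, ?g) # (k, False, ?g) # code P p ms (swp m L)"
  have "k \<notin> fst ` set ms" using Cons.prems(2) km by simp
  then have wf: "gc_wf ?w"
    by (intro gc_wf_insert) (use IH in auto)
  have ms: "mset (code P p (km # ms) L) = mset ?w"
    unfolding km mset_code_Cons[OF Cons.prems(1) m] by (cases ?g) auto
  have "labels (code P p (km # ms) L) = labels ?w"
    using mset_eq_setD[OF ms] by (simp add: labels_def)
  then show ?case using gc_wf_cong_mset[OF ms] wf IH(2) by (simp add: km)
qed

lemmas gc_wf_code = code_wf_labels[THEN conjunct1]
lemmas labels_code = code_wf_labels[THEN conjunct2]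

section \<open>Moves on codes of braid words\<close>

lemma strand_relabel:
  "strand P (map (\<lambda>(k, m). (f k, m)) ms) L t = map (\<lambda>(a, ov, s). (f a, ov, s)) (strand P ms L t)"
  by (induction ms arbitrary: L) (auto simp: Let_def)

text \<open>Relabelling is a move, so only the sequence of generators matters; \<open>f\<close>
  pairs the labels of the two words by position.\<close>

lemma code_relabel:
  assumes "numbering p L" "set (map snd ms) \<subseteq> {1..<p}" "map snd ms' = map snd ms"
    "distinct (map fst ms)" "distinct (map fst ms')"
  shows "vk_equiv (code P p ms L) (code P p ms' L)"
proof -
  define f where "f k = the (map_of (zip (map fst ms) (map fst ms')) k)" for k
  have len: "length ms' = length ms" using arg_cong[OF assms(3), of length] by simp
  have f: "f (fst (ms ! i)) = fst (ms' ! i)" if "i < length ms" for i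
  proof -
    have "map_of (zip (map fst ms) (map fst ms')) (map fst ms ! i) = Some (map fst ms' ! i)"
      using assms(4) that len by (intro map_of_zip_nth) auto
    then show ?thesis using that len by (simp add: f_def)
  qed
  have ms': "ms' = map (\<lambda>(k, m). (f k, m)) ms"
  proof (rule nth_equalityI)
    fix i assume "i < length ms'"
    then show "ms' ! i = map (\<lambda>(k, m). (f k, m)) ms ! i"
      using f[of i] len arg_cong[OF assms(3), of "\<lambda>l. l ! i"]
      by (simp add: case_prod_unfold prod_eq_iff)
  qed (simp add: len)
  have c: "code P p ms' L = map (\<lambda>(a, ov, s). (f a, ov, s)) (code P p ms L)"
    unfolding ms' by (simp only: code_def map_concat map_map comp_def strand_relabel[abs_def])
  have "inj_on f (fst ` set ms)"
  proof -
    have "map f (map fst ms) = map fst ms'" by (simp add: ms' case_prod_unfold comp_def)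
    then have "distinct (map f (map fst ms))" using assms(5) by simp
    then show ?thesis using distinct_map[of f "map fst ms"] by (metis set_map)
  qed
  then have "inj_on f (labels (code P p ms L))"
    using assms by (simp add: labels_code)
  moreover have "gc_wf (code P p ms L)" "gc_wf (code P p ms' L)"
    using assms by (intro gc_wf_code; simp)+
  ultimately show ?thesis
    unfolding c by (intro vk_equiv_move) (auto simp: vk_move_def)
qed

lemma vk_move_R2:
  assumes "gc_wf (u @ v @ x)"
    and "gc_wf (u @ [(a, True, s), (b, True, \<not> s)] @ v @ [(a, False, s), (b, False, \<not> s)] @ x)"
  shows "vk_move (u @ v @ x) (u @ [(a, True, s), (b, True, \<not> s)] @ v @ [(a, False, s), (b, False, \<not> s)] @ x)"
  using assms unfolding vk_move_def by blast

lemma vk_move_R3: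
  assumes "inj_on h {0, 1, 2}" "{i, j, k} = {0, 1, 2 :: nat}" "gc_wf w" "gc_wf w'"
    and "w = u1 @ r3_seg False c h r i @ u2 @ r3_seg False c h r j @ u3 @ r3_seg False c h r k @ u4"
    and "w' = u1 @ r3_seg True c h r i @ u2 @ r3_seg True c h r j @ u3 @ r3_seg True c h r k @ u4"
  shows "vk_move w w'"
  unfolding vk_move_def
  by (intro conjI assms(3,4) disjI2) (intro exI conjI; rule assms)

lemma upt_split: "i < n \<Longrightarrow> [a..<n] = (if a \<le> i then [a..<i] @ i # [Suc i..<n] else [a..<n])"
  by (metis le_add_diff_inverse less_imp_le upt_add_eq_append upt_conv_Cons)

text \<open>The strand with the smaller number is on top at both crossings and comes first in the
  code, so the two overpasses precede the two underpasses as in the R2 move.\<close>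

lemma code_R2:
  assumes num: "numbering p L"
    and gens: "set (map snd (u @ [(a, m), (b, m)] @ v)) \<subseteq> {1..<p}"
    and dist: "distinct (map fst (u @ [(a, m), (b, m)] @ v))"
  shows "vk_equiv (code (<) p (u @ v) L) (code (<) p (u @ [(a, m), (b, m)] @ v) L)"
proof -
  define L' where "L' = fold swp (map snd u) L"
  have m: "m \<in> {1..<p}" using gens by simp
  have num': "numbering p L'"
    unfolding L'_def using gens by (intro numbering_fold[OF num]) auto
  define lo hi s where "lo = min (L' m) (L' (Suc m))" and "hi = max (L' m) (L' (Suc m))"
    and "s = (L' m < L' (Suc m))"
  have "L' m \<noteq> L' (Suc m)" using numbering_neq[OF num' m] .
  then have lohi: "lo < hi" by (auto simp: lo_def hi_def)
  have "hi < p" using numbering_less[OF num'] m by (auto simp: hi_def)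
  define A where "A = strand (<) u L"
  define B where "B = strand (<) v L'"
  define mid where "mid t = (if t = lo then [(a, True, s), (b, True, \<not> s)]
      else if t = hi then [(a, False, s), (b, False, \<not> s)] else [])" for t
  have "strand (<) [(a, m), (b, m)] L' t = mid t" for t
    using \<open>L' m \<noteq> L' (Suc m)\<close>
    by (cases "L' m < L' (Suc m)") (auto simp: mid_def Let_def lo_def hi_def s_def)
  moreover have "fold swp (map snd [(a, m), (b, m)]) L' = L'" by simp
  ultimately have str: "strand (<) (u @ [(a, m), (b, m)] @ v) L = (\<lambda>t. A t @ mid t @ B t)"
    by (intro ext) (simp only: strand_append3 L'_def[symmetric] A_def B_def)
  have str': "strand (<) (u @ v) L = (\<lambda>t. A t @ B t)"
    by (simp add: strand_append[abs_def] L'_def A_def B_def)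
  have upt: "[0..<p] = [0..<lo] @ lo # [Suc lo..<hi] @ hi # [Suc hi..<p]"
    using upt_split[of lo p 0] upt_split[of hi p "Suc lo"] lohi \<open>hi < p\<close> by simp
  have mid: "map (\<lambda>t. A t @ mid t @ B t) xs = map (\<lambda>t. A t @ B t) xs"
    if "lo \<notin> set xs" "hi \<notin> set xs" for xs
    using that by (intro map_cong) (auto simp: mid_def)
  define U where "U = concat (map (\<lambda>t. A t @ B t) [0..<lo]) @ A lo"
  define V where "V = B lo @ concat (map (\<lambda>t. A t @ B t) [Suc lo..<hi]) @ A hi"
  define X where "X = B hi @ concat (map (\<lambda>t. A t @ B t) [Suc hi..<p])"
  have c: "code (<) p (u @ v) L = U @ V @ X"
    unfolding code_def str' upt U_def V_def X_def by simp
  have c': "code (<) p (u @ [(a, m), (b, m)] @ v) L =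
      U @ [(a, True, s), (b, True, \<not> s)] @ V @ [(a, False, s), (b, False, \<not> s)] @ X"
    unfolding code_def str upt U_def V_def X_def using lohi
    by (simp add: mid) (simp add: mid_def)
  have "gc_wf (code (<) p (u @ v) L)" "gc_wf (code (<) p (u @ [(a, m), (b, m)] @ v) L)"
    using num gens dist by (intro gc_wf_code; auto)+
  then show ?thesis
    unfolding c c' by (intro vk_equiv_move vk_move_R2)
qed

text \<open>Heights follow the strand numbers, so the three strands have a top, a middle and a
  bottom one, as R3 demands.\<close>

lemma code_R3:
  assumes num: "numbering p L"
    and gens: "set (map snd (u @ [(a, m), (b, Suc m), (d, m)] @ v)) \<subseteq> {1..<p}"
    and dist: "distinct (map fst (u @ [(a, m), (b, Suc m), (d, m)] @ v))"
  shows "vk_equiv (code (<) p (u @ [(a, m), (b, Suc m), (d, m)] @ v) L)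
    (code (<) p (u @ [(d, Suc m), (b, m), (a, Suc m)] @ v) L)"
proof -
  define L' where "L' = fold swp (map snd u) L"
  have m: "m \<in> {1..<p}" "Suc m \<in> {1..<p}" using gens by auto
  have num': "numbering p L'"
    unfolding L'_def using gens by (intro numbering_fold[OF num]) auto
  define X where "X i = L' (m + i)" for i
  have inj: "inj_on X {0, 1, 2}"
    unfolding X_def inj_on_def using numbering_eq_iff[OF num'] m by auto
  have Xp: "X i < p" if "i \<in> {0, 1, 2}" for i
    unfolding X_def using that m by (intro numbering_less[OF num']) auto
  \<comment> \<open>Subtraction from \<open>p\<close> reverses the order: strands met earlier lie
    higher.\<close>
  define h where "h i = p - X i" for i
  define r where "r = (\<lambda>_ :: nat. False)"
  \<comment> \<open>A crossing of the same two strands keeps its label, so the labels appear in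
    reverse order on the other side of the move.\<close>
  define c where "c x y = (if x = 0 then if y = 1 then a else b else d)" for x y :: nat
  have hX: "h i < h j \<longleftrightarrow> X j < X i" if "i \<in> {0, 1, 2}" "j \<in> {0, 1, 2}" for i j
    using Xp[OF that(1)] Xp[OF that(2)] by (auto simp: h_def)
  have h: "inj_on h {0, 1, 2}"
  proof (rule inj_onI)
    fix i j :: nat assume ij: "i \<in> {0, 1, 2}" "j \<in> {0, 1, 2}" "h i = h j"
    then have "X i = X j" using hX[OF ij(1,2)] hX[OF ij(2,1)] by linarith
    then show "i = j" using inj ij by (simp only: inj_onD)
  qed
  define mid where "mid side t = (if \<exists>i\<in>{0, 1, 2}. t = X i
      then r3_seg side c h r (THE i. i \<in> {0, 1, 2} \<and> t = X i) else [])" for side t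
  have midX: "mid side (X i) = r3_seg side c h r i" if "i \<in> {0, 1, 2}" for side i
  proof -
    have "(THE j. j \<in> {0, 1, 2} \<and> X i = X j) = i"
      using inj that by (intro the_equality) (auto simp: inj_on_def)
    then show ?thesis using that unfolding mid_def by auto
  qed
  have mid_else: "mid side t = []" if "t \<noteq> X 0" "t \<noteq> X 1" "t \<noteq> X 2" for side t
    using that by (simp add: mid_def)
  have X: "L' m = X 0" "L' (Suc m) = X 1" "L' (Suc (Suc m)) = X 2"
    by (simp_all add: X_def)
  have ne: "X 0 \<noteq> X 1" "X 1 \<noteq> X 2" "X 0 \<noteq> X 2" using inj by (auto simp: inj_on_def)
  have h01: "h 0 < h 1 \<longleftrightarrow> X 1 < X 0" "h 1 < h 0 \<longleftrightarrow> X 0 < X 1" 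
    "h 0 < h 2 \<longleftrightarrow> X 2 < X 0" "h 2 < h 0 \<longleftrightarrow> X 0 < X 2"
    "h 1 < h 2 \<longleftrightarrow> X 2 < X 1" "h 2 < h 1 \<longleftrightarrow> X 1 < X 2"
    using hX by simp_all
  have gt: "X 1 < X 0 \<longleftrightarrow> \<not> X 0 < X 1" "X 2 < X 1 \<longleftrightarrow> \<not> X 1 < X 2" "X 2 < X 0 \<longleftrightarrow> \<not> X 0 < X 2"
    using ne by auto
  have seg: "r3_seg False c h r 0 = [(a, X 0 < X 1, X 0 < X 1), (b, X 0 < X 2, X 0 < X 2)]"
    "r3_seg False c h r 1 = [(a, \<not> X 0 < X 1, X 0 < X 1), (d, X 1 < X 2, X 1 < X 2)]"
    "r3_seg False c h r 2 = [(b, \<not> X 0 < X 2, X 0 < X 2), (d, \<not> X 1 < X 2, X 1 < X 2)]"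
    "r3_seg True c h r i = rev (r3_seg False c h r i)" for i
    unfolding r3_seg_def r3_others_def r3_letter_def r_def c_def using h01 gt
    by (simp_all add: Let_def numeral_2_eq_2)
  have swps: "swp m L' m = X 1" "swp m L' (Suc m) = X 0" "swp m L' (Suc (Suc m)) = X 2"
    "swp (Suc m) (swp m L') m = X 1" "swp (Suc m) (swp m L') (Suc m) = X 2"
    "swp (Suc m) L' m = X 0" "swp (Suc m) L' (Suc m) = X 2" "swp (Suc m) L' (Suc (Suc m)) = X 1"
    "swp m (swp (Suc m) L') (Suc m) = X 0" "swp m (swp (Suc m) L') (Suc (Suc m)) = X 1"
    by (simp_all add: X)
  have strF: "strand (<) [(a, m), (b, Suc m), (d, m)] L' t = mid False t" for t
  proof -
    consider "t = X 0" | "t = X 1" | "t = X 2" | "t \<noteq> X 0" "t \<noteq> X 1" "t \<noteq> X 2" by blast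
    then show ?thesis
      by cases (simp_all add: midX seg mid_else swps X ne ne[symmetric] Let_def del: One_nat_def)
  qed
  have strT: "strand (<) [(d, Suc m), (b, m), (a, Suc m)] L' t = mid True t" for t
  proof -
    consider "t = X 0" | "t = X 1" | "t = X 2" | "t \<noteq> X 0" "t \<noteq> X 1" "t \<noteq> X 2" by blast
    then show ?thesis
      by cases (simp_all add: midX seg mid_else swps X ne ne[symmetric] Let_def del: One_nat_def)
  qed
  define A where "A = strand (<) u L"
  define B where "B = strand (<) v (fold swp [m, Suc m, m] L')"
  have braid: "fold swp [Suc m, m, Suc m] L' = fold swp [m, Suc m, m] L'"
    by (auto simp: swp_def)
  have str: "strand (<) (u @ [(a, m), (b, Suc m), (d, m)] @ v) L = (\<lambda>t. A t @ mid False t @ B t)"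
    by (intro ext) (simp only: strand_append3 L'_def[symmetric] A_def B_def strF list.map snd_conv)
  have str': "strand (<) (u @ [(d, Suc m), (b, m), (a, Suc m)] @ v) L = (\<lambda>t. A t @ mid True t @ B t)"
    by (intro ext) (simp only: strand_append3 L'_def[symmetric] A_def B_def strT list.map snd_conv braid)
  \<comment> \<open>The order in which the knot meets the three strands; the move allows every
    order.\<close>
  obtain i j k where ijk: "{i, j, k} = {0, 1, 2 :: nat}" and lt: "X i < X j" "X j < X k"
  proof -
    have "X 0 < X 1 \<and> X 1 < X 2 \<or> X 0 < X 2 \<and> X 2 < X 1 \<or> X 1 < X 0 \<and> X 0 < X 2 \<or>
      X 1 < X 2 \<and> X 2 < X 0 \<or> X 2 < X 0 \<and> X 0 < X 1 \<or> X 2 < X 1 \<and> X 1 < X 0"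
      using ne by linarith
    then show thesis
      using that[of 0 1 2] that[of 0 2 1] that[of 1 0 2] that[of 1 2 0] that[of 2 0 1] that[of 2 1 0]
      by (simp add: insert_commute) blast
  qed
  have mem: "i \<in> {0, 1, 2}" "j \<in> {0, 1, 2}" "k \<in> {0, 1, 2}" using ijk by blast+
  have upt: "[0..<p] = [0..<X i] @ X i # [Suc (X i)..<X j] @ X j # [Suc (X j)..<X k] @ X k # [Suc (X k)..<p]"
    using upt_split[of "X i" p 0] upt_split[of "X j" p "Suc (X i)"] upt_split[of "X k" p "Suc (X j)"]
      lt Xp[OF mem(3)] by simp
  have mid: "map (\<lambda>t. A t @ mid side t @ B t) xs = map (\<lambda>t. A t @ B t) xs"
    if "X i \<notin> set xs" "X j \<notin> set xs" "X k \<notin> set xs" for xs side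
  proof (intro map_cong refl)
    fix t assume "t \<in> set xs"
    then have "\<forall>l\<in>{i, j, k}. t \<noteq> X l" using that by auto
    then have "mid side t = []" unfolding ijk by (intro mid_else) auto
    then show "A t @ mid side t @ B t = A t @ B t" by simp
  qed
  define u1 where "u1 = concat (map (\<lambda>t. A t @ B t) [0..<X i]) @ A (X i)"
  define u2 where "u2 = B (X i) @ concat (map (\<lambda>t. A t @ B t) [Suc (X i)..<X j]) @ A (X j)"
  define u3 where "u3 = B (X j) @ concat (map (\<lambda>t. A t @ B t) [Suc (X j)..<X k]) @ A (X k)"
  define u4 where "u4 = B (X k) @ concat (map (\<lambda>t. A t @ B t) [Suc (X k)..<p])"
  have c: "concat (map (\<lambda>t. A t @ mid side t @ B t) [0..<p]) = u1 @ r3_seg side c h r i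
      @ u2 @ r3_seg side c h r j @ u3 @ r3_seg side c h r k @ u4" for side
    unfolding upt u1_def u2_def u3_def u4_def using lt
    by (simp add: mid midX[OF mem(1)] midX[OF mem(2)] midX[OF mem(3)])
  have "gc_wf (code (<) p (u @ [(a, m), (b, Suc m), (d, m)] @ v) L)"
    "gc_wf (code (<) p (u @ [(d, Suc m), (b, m), (a, Suc m)] @ v) L)"
    using num gens dist by (intro gc_wf_code; auto)+
  moreover have "code (<) p (u @ [(a, m), (b, Suc m), (d, m)] @ v) L = u1 @ r3_seg False c h r i
      @ u2 @ r3_seg False c h r j @ u3 @ r3_seg False c h r k @ u4"
    unfolding code_def str by (rule c)
  moreover have "code (<) p (u @ [(d, Suc m), (b, m), (a, Suc m)] @ v) L = u1 @ r3_seg True c h r i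
      @ u2 @ r3_seg True c h r j @ u3 @ r3_seg True c h r k @ u4"
    unfolding code_def str' by (rule c)
  ultimately show ?thesis
    by (intro vk_equiv_move vk_move_R3[OF h ijk])
qed

text \<open>No strand meets both crossings, so exchanging them leaves each strand, and with it the
  code, literally unchanged.\<close>

lemma code_far:
  assumes num: "numbering p L"
    and gens: "set (map snd (u @ [(a, m), (b, n)] @ v)) \<subseteq> {1..<p}"
    and "Suc m < n"
  shows "code P p (u @ [(a, m), (b, n)] @ v) L = code P p (u @ [(b, n), (a, m)] @ v) L"
proof -
  define L' where "L' = fold swp (map snd u) L"
  have num': "numbering p L'"
    unfolding L'_def using gens by (intro numbering_fold[OF num]) auto
  have ne: "L' x \<noteq> L' y" if "x \<in> {m, Suc m}" "y \<in> {n, Suc n}" for x y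
    using numbering_eq_iff[OF num', of x y] that assms(3) gens by auto
  have sw: "swp m L' n = L' n" "swp m L' (Suc n) = L' (Suc n)"
    "swp n L' m = L' m" "swp n L' (Suc m) = L' (Suc m)" "swp n (swp m L') = swp m (swp n L')"
    using assms(3) by (auto simp: swp_def)
  have "strand P (u @ [(a, m), (b, n)] @ v) L t = strand P (u @ [(b, n), (a, m)] @ v) L t" for t
    using ne[of m n] ne[of m "Suc n"] ne[of "Suc m" n] ne[of "Suc m" "Suc n"]
    by (auto simp: strand_append L'_def[symmetric] Let_def sw)
  then have "strand P (u @ [(a, m), (b, n)] @ v) L = strand P (u @ [(b, n), (a, m)] @ v) L" ..
  then show ?thesis by (simp only: code_def)
qed

lemma concat_shift:
  "concat (map (\<lambda>t. A t @ B t) [0..<n]) @ A n = A 0 @ concat (map (\<lambda>t. B t @ A (Suc t)) [0..<n])"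
  by (induction n) auto

text \<open>The two words are equal letter by letter: the crossing moves from the beginning of two
  strands to the end of their predecessors, which are directly joined to them. The strand with
  number 0 has no predecessor, hence \<open>Suc m < p\<close>.\<close>

lemma code_conj:
  assumes num: "numbering p L" and m: "1 \<le> m" "Suc m < p" and 0: "L p = 0"
    and gens: "set (map snd ms) \<subseteq> {1..<p}"
    and link: "\<And>x. x \<in> {1..<p} \<Longrightarrow> L x = Suc (fold swp (map snd ms) (swp m L) (Suc x))"
  shows "code (<) p ((a, m) # ms) L = code (<) p (ms @ [(a, Suc m)]) (swp m L)"
proof -
  define M where "M = fold swp (map snd ms) (swp m L)"
  define g where "g = (L m < L (Suc m))"
  define A where "A t = (if t = L m then [(a, g, g)] else if t = L (Suc m) then [(a, \<not> g, g)] else [])" for t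
  define B where "B = strand (<) ms (swp m L)"
  \<comment> \<open>The predecessors of both strands have numbers smaller by one, so their order,
    and with it level and sign of the crossing, is preserved.\<close>
  have M: "L m = Suc (M (Suc m))" "L (Suc m) = Suc (M (Suc (Suc m)))"
    using link[of m] link[of "Suc m"] m by (auto simp: M_def)
  have "strand (<) ((a, m) # ms) L = (\<lambda>t. A t @ B t)"
    by (auto simp: fun_eq_iff A_def B_def Let_def g_def)
  moreover have "strand (<) (ms @ [(a, Suc m)]) (swp m L) = (\<lambda>t. B t @ A (Suc t))"
    by (auto simp: fun_eq_iff strand_append M_def[symmetric] A_def B_def Let_def g_def M)
  \<comment> \<open>The boundary terms of the shift vanish: both numbers at the crossing are
    successors and less than \<open>p\<close>.\<close>
  moreover have "A 0 = []" using M by (simp add: A_def)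
  moreover have "A p = []"
    using numbering_less[OF num, of m] numbering_less[OF num, of "Suc m"] m by (simp add: A_def)
  ultimately show ?thesis
    using concat_shift[of A B p] by (simp add: code_def)
qed

text \<open>Standard labels let diagrams be indexed by plain words; \<open>descending_eq\<close>
  restores them after each move.\<close>

definition descending :: "nat \<Rightarrow> nat list \<Rightarrow> (nat \<Rightarrow> nat) \<Rightarrow> gcode" where
  "descending p ms L = code (<) p (enumerate 0 ms) L"

lemma descending_eq:
  assumes "numbering p L" "set (map snd ms) \<subseteq> {1..<p}" "distinct (map fst ms)"
  shows "vk_equiv (descending p (map snd ms) L) (code (<) p ms L)"
  unfolding descending_def using assms
  by (intro code_relabel) auto

lemma descending_square:
  assumes "numbering p L" "set (u @ [m, m] @ v) \<subseteq> {1..<p}"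
  shows "vk_equiv (descending p (u @ [m, m] @ v) L) (descending p (u @ v) L)"
proof -
  let ?n = "length u"
  let ?u = "enumerate 0 u" and ?v = "enumerate (Suc (Suc ?n)) v"
  have "vk_equiv (descending p (map snd (?u @ ?v)) L) (code (<) p (?u @ ?v) L)"
    using assms by (intro descending_eq) auto
  also have "vk_equiv (code (<) p (?u @ ?v) L) (code (<) p (?u @ [(?n, m), (Suc ?n, m)] @ ?v) L)"
    using assms by (intro code_R2) auto
  also have "?u @ [(?n, m), (Suc ?n, m)] @ ?v = enumerate 0 (u @ [m, m] @ v)"
    by (simp add: enumerate_append_eq)
  finally have "vk_equiv (descending p (u @ v) L) (descending p (u @ [m, m] @ v) L)"
    by (simp add: descending_def)
  then show ?thesis by (rule vk_equiv_sym)
qed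

lemma descending_braid:
  assumes "numbering p L" "set (u @ [m, Suc m, m] @ v) \<subseteq> {1..<p}"
  shows "vk_equiv (descending p (u @ [m, Suc m, m] @ v) L) (descending p (u @ [Suc m, m, Suc m] @ v) L)"
proof -
  let ?n = "length u"
  let ?u = "enumerate 0 u" and ?v = "enumerate (Suc (Suc (Suc ?n))) v"
  have "vk_equiv (code (<) p (?u @ [(?n, m), (Suc ?n, Suc m), (Suc (Suc ?n), m)] @ ?v) L)
    (code (<) p (?u @ [(Suc (Suc ?n), Suc m), (Suc ?n, m), (?n, Suc m)] @ ?v) L)" (is "vk_equiv ?x (code _ _ ?y _)")
    using assms by (intro code_R3) auto
  also have "vk_equiv (code (<) p ?y L) (descending p (map snd ?y) L)"
    using assms by (intro vk_equiv_sym[OF descending_eq]) auto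
  also have "map snd ?y = u @ [Suc m, m, Suc m] @ v" by simp
  also have "?x = descending p (u @ [m, Suc m, m] @ v) L"
    by (simp add: descending_def enumerate_append_eq)
  finally show ?thesis .
qed

lemma descending_far:
  assumes "numbering p L" "set (u @ [m, n] @ v) \<subseteq> {1..<p}" "Suc m < n"
  shows "vk_equiv (descending p (u @ [m, n] @ v) L) (descending p (u @ [n, m] @ v) L)"
proof -
  let ?n = "length u"
  let ?u = "enumerate 0 u" and ?v = "enumerate (Suc (Suc ?n)) v"
  have "descending p (u @ [m, n] @ v) L = code (<) p (?u @ [(?n, m), (Suc ?n, n)] @ ?v) L"
    by (simp add: descending_def enumerate_append_eq)
  also have "\<dots> = code (<) p (?u @ [(Suc ?n, n), (?n, m)] @ ?v) L" (is "_ = code _ _ ?y _")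
    using assms by (intro code_far) auto
  also have "vk_equiv (code (<) p ?y L) (descending p (map snd ?y) L)"
    using assms by (intro vk_equiv_sym[OF descending_eq]) auto
  also have "map snd ?y = u @ [n, m] @ v" by simp
  finally show ?thesis .
qed

lemma descending_conj:
  assumes "numbering p L" "1 \<le> m" "Suc m < p" "L p = 0" "set ms \<subseteq> {1..<p}"
    and link: "\<And>x. x \<in> {1..<p} \<Longrightarrow> L x = Suc (fold swp ms (swp m L) (Suc x))"
  shows "vk_equiv (descending p (m # ms) L) (descending p (ms @ [Suc m]) (swp m L))"
proof -
  let ?ms = "enumerate (Suc 0) ms"
  have "descending p (m # ms) L = code (<) p ((0, m) # ?ms) L"
    by (simp add: descending_def)
  also have "\<dots> = code (<) p (?ms @ [(0, Suc m)]) (swp m L)"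
    using assms by (intro code_conj) auto
  also have "vk_equiv \<dots> (descending p (map snd (?ms @ [(0, Suc m)])) (swp m L))"
    using assms(1-5) by (intro vk_equiv_sym[OF descending_eq] numbering_swp) auto
  finally show ?thesis by simp
qed

section \<open>Coxeter relations\<close>

text \<open>The Coxeter presentation of the symmetric group, on words. Only \<open>square\<close>
  bounds its letter, because read backwards it introduces new ones.\<close>

inductive cox :: "nat \<Rightarrow> nat list \<Rightarrow> nat list \<Rightarrow> bool" for p where
  refl [simp]: "cox p u u"
| sym: "cox p u v \<Longrightarrow> cox p v u"
| trans [trans]: "cox p u v \<Longrightarrow> cox p v w \<Longrightarrow> cox p u w"
| square: "m \<in> {1..<p} \<Longrightarrow> cox p (u @ [m, m] @ v) (u @ v)"
| braid: "cox p (u @ [m, Suc m, m] @ v) (u @ [Suc m, m, Suc m] @ v)"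
| far: "Suc m < n \<Longrightarrow> cox p (u @ [m, n] @ v) (u @ [n, m] @ v)"

lemma cox_set: "cox p u v \<Longrightarrow> set u \<subseteq> {1..<p} \<longleftrightarrow> set v \<subseteq> {1..<p}"
  by (induction rule: cox.induct) auto

lemma cox_cong: "cox p u v \<Longrightarrow> cox p (x @ u @ y) (x @ v @ y)"
proof (induction rule: cox.induct)
  case (square m u v)
  then show ?case using cox.square[of m p "x @ u" "v @ y"] by simp
next
  case (braid u m v)
  then show ?case using cox.braid[of p "x @ u" m "v @ y"] by simp
next
  case (far m n u v)
  then show ?case using cox.far[of m n p "x @ u" "v @ y"] by simp
qed (auto intro: cox.sym cox.trans)

lemma cox_fold: "cox p u v \<Longrightarrow> fold swp u L = fold swp v L"
proof (induction arbitrary: L rule: cox.induct)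
  case (braid u m v)
  have "swp m (swp (Suc m) (swp m K)) = swp (Suc m) (swp m (swp (Suc m) K))" for K
    by (auto simp: swp_def)
  then show ?case by simp
next
  case (far m n u v)
  then have "swp n (swp m K) = swp m (swp n K)" for K
    by (auto simp: swp_def)
  then show ?case by simp
qed auto

text \<open>\<open>square\<close> is an R2 move, \<open>braid\<close> an R3 move, and
  \<open>far\<close> a relabelling.\<close>

lemma cox_descending:
  assumes "cox p u v" "set u \<subseteq> {1..<p}" "numbering p L"
  shows "vk_equiv (descending p u L) (descending p v L)"
  using assms
proof (induction rule: cox.induct)
  case (sym u v)
  then show ?case using cox_set vk_equiv_sym by blast
next
  case (trans u v w)
  then show ?case using cox_set vk_equiv_trans by blast
next
  case (square m u v)
  then show ?case by (intro descending_square) auto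
next
  case (braid u m v)
  then show ?case by (intro descending_braid)
next
  case (far m n u v)
  then show ?case by (intro descending_far)
qed simp

section \<open>Normal forms in the symmetric group\<close>

lemma cox_commute:
  assumes "\<forall>j\<in>set xs. Suc j < i \<or> Suc i < j"
  shows "cox p (xs @ [i]) (i # xs)"
  using assms
proof (induction xs)
  case (Cons j xs)
  have "cox p ((j # xs) @ [i]) (j # i # xs)"
    using cox_cong[OF Cons.IH, of "[j]" "[]"] Cons.prems by simp
  also have "cox p (j # i # xs) (i # j # xs)"
    using Cons.prems cox.far[of j i p "[]" xs] cox.sym[OF cox.far[of i j p "[]" xs]] by auto
  finally show ?case by simp
qed simp

text \<open>The runs \<open>n, n - 1, ..., k\<close> represent the cosets of the subgroup generated
  by the letters below \<open>n\<close>; the run is empty for \<open>k = Suc n\<close>.\<close>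

lemma cox_normal_form:
  assumes "set ms \<subseteq> {1..<Suc n}" "n < p"
  shows "\<exists>w k. set w \<subseteq> {1..<n} \<and> k \<in> {1..Suc n} \<and> cox p ms (w @ rev [k..<Suc n])"
  using assms(1)
proof (induction ms rule: rev_induct)
  case Nil
  have "cox p [] ([] @ rev [Suc n..<Suc n])" by simp
  then show ?case by (intro exI[of _ "[]"] exI[of _ "Suc n"]) simp
next
  case (snoc i ms)
  then obtain w k where w: "set w \<subseteq> {1..<n}" and k: "k \<in> {1..Suc n}"
    and c: "cox p ms (w @ rev [k..<Suc n])" by auto
  have i: "1 \<le> i" "i \<le> n" using snoc.prems by auto
  have c': "cox p (ms @ [i]) (w @ rev [k..<Suc n] @ [i])"
    using cox_cong[OF c, of "[]" "[i]"] by simp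
  \<comment> \<open>The new letter extends the run, cancels its last letter, commutes past it, or
    passes through it by a braid relation and emerges as \<open>i - 1\<close>.\<close>
  consider "Suc i = k" | "i = k" | "Suc i < k" | "k < i" by linarith
  then show ?case
  proof cases
    case 1
    then have "rev [k..<Suc n] @ [i] = rev [i..<Suc n]" using i by (simp add: upt_conv_Cons)
    with c' have "cox p (ms @ [i]) (w @ rev [i..<Suc n])" by simp
    then show ?thesis using w i by (intro exI[of _ w] exI[of _ i]) simp
  next
    case 2
    then have e: "rev [k..<Suc n] @ [i] = rev [Suc i..<Suc n] @ [i, i]"
      using i by (simp add: upt_conv_Cons)
    note c'
    also have "w @ rev [k..<Suc n] @ [i] = (w @ rev [Suc i..<Suc n]) @ [i, i] @ []"
      unfolding e by simp
    also have "cox p \<dots> ((w @ rev [Suc i..<Suc n]) @ [])"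
      using i assms(2) by (intro cox.square) auto
    finally show ?thesis using w i by (intro exI[of _ w] exI[of _ "Suc i"]) simp
  next
    case 3
    have "cox p (rev [k..<Suc n] @ [i]) (i # rev [k..<Suc n])"
      using 3 by (intro cox_commute) auto
    note cox.trans[OF c' cox_cong[OF this, of w "[]", simplified append_Nil2]]
    then have "cox p (ms @ [i]) ((w @ [i]) @ rev [k..<Suc n])" by simp
    then show ?thesis using w k i 3 by (intro exI[of _ "w @ [i]"] exI[of _ k]) simp
  next
    case 4
    define j where "j = i - 1"
    have j: "i = Suc j" "k \<le> j" "j < n" using 4 i by (auto simp: j_def)
    define R1 where "R1 = rev [Suc i..<Suc n]"
    define R2 where "R2 = rev [k..<j]"
    have "[k..<Suc n] = [k..<j] @ [j, i] @ [Suc i..<Suc n]"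
      using j upt_add_eq_append[of k j "Suc n - j"] by (simp add: upt_conv_Cons del: upt_Suc)
    then have R: "rev [k..<Suc n] = R1 @ [i, j] @ R2"
      by (simp add: R1_def R2_def del: upt_Suc)
    have "cox p (R2 @ [i]) (i # R2)"
      by (intro cox_commute) (auto simp: R2_def j)
    from cox_cong[OF this, of "R1 @ [i, j]" "[]"]
    have "cox p (rev [k..<Suc n] @ [i]) (R1 @ [Suc j, j, Suc j] @ R2)"
      by (simp add: R j del: upt_Suc)
    also have "cox p \<dots> (R1 @ [j, Suc j, j] @ R2)"
      by (rule cox.sym[OF cox.braid])
    also have "cox p \<dots> ((j # R1) @ [Suc j, j] @ R2)"
    proof -
      have "cox p (R1 @ [j]) (j # R1)"
        by (intro cox_commute) (auto simp: R1_def j)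
      from cox_cong[OF this, of "[]" "[Suc j, j] @ R2"] show ?thesis by simp
    qed
    also have "\<dots> = [j] @ rev [k..<Suc n]" by (simp add: R j del: upt_Suc)
    finally have "cox p (rev [k..<Suc n] @ [i]) ([j] @ rev [k..<Suc n])" .
    note cox.trans[OF c' cox_cong[OF this, of w "[]", simplified append_Nil2]]
    then have "cox p (ms @ [i]) ((w @ [j]) @ rev [k..<Suc n])" by simp
    then show ?thesis using w k j by (intro exI[of _ "w @ [j]"] exI[of _ k]) auto
  qed
qed

lemma fold_swp_other:
  assumes "\<forall>m\<in>set ms. x \<noteq> m \<and> x \<noteq> Suc m"
  shows "fold swp ms L x = L x"
  using assms by (induction ms arbitrary: L) auto

lemma fold_swp_rev_upt:
  assumes "k \<le> n"
  shows "fold swp (rev [k..<n]) L k = L n"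
  using assms by (induction n arbitrary: L rule: dec_induct) auto

text \<open>The run of the normal form carries the entry at position \<open>n + 1\<close> to
  \<open>k\<close>. If nothing moves, the run is empty and \<open>n\<close> can be lowered.\<close>

lemma cox_identity:
  assumes "set ms \<subseteq> {1..<n}" "n \<le> p" "inj_on L {1..n}" "\<forall>x\<in>{1..n}. fold swp ms L x = L x"
  shows "cox p ms []"
  using assms
proof (induction n arbitrary: ms)
  case (Suc n)
  then obtain w k where w: "set w \<subseteq> {1..<n}" and k: "k \<in> {1..Suc n}"
    and c: "cox p ms (w @ rev [k..<Suc n])" using cox_normal_form[of ms n p] by auto
  have f: "fold swp ms L = fold swp (rev [k..<Suc n]) (fold swp w L)"
    using cox_fold[OF c, of L] by simp
  have "fold swp ms L k = fold swp w L (Suc n)"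
    unfolding f using k by (intro fold_swp_rev_upt) simp
  also have "\<dots> = L (Suc n)"
    using w by (intro fold_swp_other) auto
  finally have "L k = L (Suc n)" using Suc.prems(4) k by simp
  then have "k = Suc n" using Suc.prems(3) k by (auto dest: inj_onD)
  then have c: "cox p ms w" and f: "fold swp ms L = fold swp w L" using c f by simp_all
  have "cox p w []"
  proof (rule Suc.IH)
    show "inj_on L {1..n}" using Suc.prems(3) by (rule inj_on_subset) auto
    show "\<forall>x\<in>{1..n}. fold swp w L x = L x" using Suc.prems(4) f by auto
  qed (use w Suc.prems in auto)
  with c show ?case by (rule cox.trans)
qed simp

text \<open>As long as two neighbouring strands below position \<open>p\<close> are numbered in increasing order,
  insert \<open>[m, m]\<close> in front and conjugate by the first \<open>m\<close> to swap their numbers. Once the numbers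
  are sorted, the braid has to induce the identity permutation.\<close>

lemma descending_trivial:
  assumes "numbering p L" "L p = 0" "set ms \<subseteq> {1..<p}"
    and "\<forall>x\<in>{1..<p}. L x = Suc (fold swp ms L (Suc x))"
  shows "vk_equiv (descending p ms L) []"
  using assms
\<comment> \<open>Exchanging neighbours in increasing order lowers this sum by their difference, so
  the sorting terminates.\<close>
proof (induction "\<Sum>x\<in>{1..p}. x * L x" arbitrary: L ms rule: less_induct)
  case less
  note num = less.prems(1) and L0 = less.prems(2) and gens = less.prems(3) and link = less.prems(4)
  show ?case
  proof (cases "\<exists>m. 1 \<le> m \<and> Suc m < p \<and> L m < L (Suc m)")
    case True
    then obtain m where m: "1 \<le> m" "Suc m < p" "L m < L (Suc m)" by blast
    define L' where "L' = swp m L"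
    define ms' where "ms' = m # ms @ [Suc m]"
    have num': "numbering p L'" unfolding L'_def using num m by (intro numbering_swp) auto
    have fold: "fold swp ms' L' = swp (Suc m) (fold swp ms L)"
      by (simp add: ms'_def L'_def)
    have "vk_equiv (descending p ms L) (descending p (m # (m # ms)) L)"
      by (rule vk_equiv_sym) (use descending_square[OF num, of "[]" m ms] gens m in simp)
    also have "vk_equiv \<dots> (descending p ms' L')"
    proof -
      have "L x = Suc (fold swp (m # ms) (swp m L) (Suc x))" if "x \<in> {1..<p}" for x
        using bspec[OF link that] by simp
      from descending_conj[OF num m(1,2) L0 _ this] gens m
      show ?thesis by (simp add: ms'_def L'_def)
    qed
    also have "vk_equiv \<dots> []"
    proof (rule less.hyps[OF _ num'])
      have split: "{1..p} = insert m (insert (Suc m) ({1..p} - {m, Suc m}))" using m by auto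
      have "(\<Sum>x\<in>{1..p}. x * L' x) = m * L (Suc m) + Suc m * L m + (\<Sum>x\<in>{1..p} - {m, Suc m}. x * L' x)"
        by (subst split) (simp add: L'_def)
      also have "(\<Sum>x\<in>{1..p} - {m, Suc m}. x * L' x) = (\<Sum>x\<in>{1..p} - {m, Suc m}. x * L x)"
        by (intro sum.cong) (auto simp: L'_def)
      also have "m * L (Suc m) + Suc m * L m + (\<Sum>x\<in>{1..p} - {m, Suc m}. x * L x)
          < m * L m + Suc m * L (Suc m) + (\<Sum>x\<in>{1..p} - {m, Suc m}. x * L x)"
        using m(3) by simp
      also have "\<dots> = (\<Sum>x\<in>{1..p}. x * L x)"
        by (subst (2) split) simp
      finally show "(\<Sum>x\<in>{1..p}. x * L' x) < (\<Sum>x\<in>{1..p}. x * L x)" .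
      show "L' p = 0" using L0 m by (simp add: L'_def)
      show "set ms' \<subseteq> {1..<p}" using gens m by (auto simp: ms'_def)
      show "\<forall>x\<in>{1..<p}. L' x = Suc (fold swp ms' L' (Suc x))"
      proof
        fix x assume x: "x \<in> {1..<p}"
        consider "x = m" | "x = Suc m" | "x \<noteq> m" "x \<noteq> Suc m" by blast
        then show "L' x = Suc (fold swp ms' L' (Suc x))"
        proof cases
          case 1
          then show ?thesis using bspec[OF link, of "Suc m"] m unfolding fold by (simp add: L'_def)
        next
          case 2
          then show ?thesis using bspec[OF link, of m] m unfolding fold by (simp add: L'_def)
        next
          case 3
          then show ?thesis using bspec[OF link x] unfolding fold by (simp add: L'_def)
        qed
      qed
    qed
    finally show ?thesis .
  next
    case False
    have dec: "L (Suc x) < L x" if "x \<in> {1..<p}" for x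
    proof (cases "Suc x = p")
      case True
      then show ?thesis using numbering_neq[OF num that] L0 by simp
    next
      case False
      then show ?thesis
        using \<open>\<nexists>m. _ m\<close> numbering_neq[OF num that] that by (metis Suc_lessI atLeastLessThan_iff linorder_neqE_nat)
    qed
    \<comment> \<open>Strict descent from a number below \<open>p\<close> to \<open>L p = 0\<close>
      forces \<open>L x = p - x\<close>; \<open>up\<close> and \<open>down\<close> argue from the
      two ends.\<close>
    have up: "L x + x \<le> p" if "1 \<le> x" "x \<le> p" for x
      using that
    proof (induction x rule: dec_induct)
      case base
      then show ?case using numbering_less[OF num, of 1] by simp
    next
      case (step x)
      then show ?case using dec[of x] by simp
    qed
    have down: "p \<le> L x + x" if "x \<le> p" "1 \<le> x" for x
      using that
    proof (induction x rule: inc_induct)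
      case (step x)
      then show ?case using dec[of x] by simp
    qed (simp add: L0)
    have L: "L x = p - x" if "x \<in> {1..p}" for x
      using up[of x] down[of x] that by simp
    define M where "M = fold swp ms L"
    have numM: "numbering p M" unfolding M_def by (rule numbering_fold[OF num gens])
    have M: "M (Suc x) = L (Suc x)" if "x \<in> {1..<p}" for x
    proof -
      have "L x = Suc (M (Suc x))" using bspec[OF link that] by (simp add: M_def)
      then show ?thesis using L[of x] L[of "Suc x"] that by simp
    qed
    \<comment> \<open>\<open>link\<close> says nothing about the end position 1, which receives the
      only number left over.\<close>
    have M1: "M 1 = L 1" if "1 \<le> p"
    proof -
      have "M 1 < p" using numbering_less[OF numM, of 1] that by simp
      then obtain y where y: "y \<in> {1..p}" "L y = M 1" using numbering_obtain[OF num] by metis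
      have "y = 1"
      proof (rule ccontr)
        assume "y \<noteq> 1"
        then have "y - 1 \<in> {1..<p}" using y(1) by auto
        from M[OF this] have "M y = L y" using y(1) by simp
        then show False using numbering_eq_iff[OF numM, of y 1] y \<open>y \<noteq> 1\<close> that by simp
      qed
      with y show ?thesis by simp
    qed
    have "M x = L x" if "x \<in> {1..p}" for x
    proof (cases "x = 1")
      case True
      then show ?thesis using M1 that by simp
    next
      case False
      then have "x - 1 \<in> {1..<p}" using that by auto
      from M[OF this] show ?thesis using that by simp
    qed
    then have "cox p ms []"
      using gens num by (intro cox_identity[of ms p p L]) (auto simp: M_def bij_betw_def)
    then have "vk_equiv (descending p ms L) (descending p [] L)"
      using gens num by (intro cox_descending)
    also have "descending p [] L = []"
      unfolding descending_def code_def by (induction p) auto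
    finally show ?thesis .
  qed
qed

section \<open>Closures of torus braids\<close>

lemma bpass_append:
  "bpass k (xs @ ys) pos = (let (l, e) = bpass k xs pos; (l', e') = bpass (k + length xs) ys e in (l @ l', e'))"
  by (induction xs arbitrary: k pos) (auto simp: split_beta Let_def)

lemma bpass_Vir:
  assumes "a \<le> b"
  shows "bpass k (map Vir [a..<b]) pos =
    ([], if pos = a then b else if a < pos \<and> pos \<le> b then pos - 1 else pos)"
  using assms by (induction b rule: dec_induct) (auto simp: bpass_append)

text \<open>A strand is followed by its number, which stays constant while its position
  changes.\<close>

lemma bpass_Sig:
  assumes "numbering p L" "set ms \<subseteq> {1..<p}" "pos \<in> {1..p}"
  shows "\<exists>e\<in>{1..p}. fold swp ms L e = L pos \<and>
    bpass k (map Sig ms) pos = (strand (\<lambda>_ _. True) (enumerate k ms) L (L pos), e)"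
  using assms
proof (induction ms arbitrary: k L pos)
  case (Cons m ms)
  define pos' where "pos' = (if pos = m then Suc m else if pos = Suc m then m else pos)"
  have m: "m \<in> {1..<p}" using Cons.prems by simp
  have pos': "pos' \<in> {1..p}" "swp m L pos' = L pos" using Cons.prems by (auto simp: pos'_def)
  obtain e where e: "e \<in> {1..p}" "fold swp ms (swp m L) e = L pos"
    "bpass (Suc k) (map Sig ms) pos' = (strand (\<lambda>_ _. True) (enumerate (Suc k) ms) (swp m L) (L pos), e)"
    using Cons.IH[OF numbering_swp[OF Cons.prems(1) m] _ pos'(1), of "Suc k"] Cons.prems pos'(2) by auto
  have "L m = L pos \<longleftrightarrow> pos = m" "L (Suc m) = L pos \<longleftrightarrow> pos = Suc m"
    using numbering_eq_iff[OF Cons.prems(1) _ Cons.prems(3), of m]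
      numbering_eq_iff[OF Cons.prems(1) _ Cons.prems(3), of "Suc m"] m by auto
  then show ?case using e by (intro bexI[of _ e]) (auto simp: pos'_def Let_def)
qed simp

text \<open>\<open>pos\<close> is the position in front of the virtual block, which takes 1 to
  \<open>p\<close> and lowers every other position by one; \<open>t\<close> is the number of the
  strand entered behind it, and \<open>n\<close> counts the remaining runs.\<close>

lemma close_iter_code:
  assumes num: "numbering p L" and gens: "set ms \<subseteq> {1..<p}"
    and link: "\<forall>x\<in>{1..<p}. L x = Suc (fold swp ms L (Suc x))"
    and pos: "pos \<in> {1..p}" "L (if pos = 1 then p else pos - 1) = t" "n + t = p"
  shows "close_iter (map Vir [1..<p] @ map Sig ms) n pos =
    concat (map (strand (\<lambda>_ _. True) (enumerate (p - 1) ms) L) [t..<p])"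
  using pos
proof (induction n arbitrary: pos t)
  case (Suc n)
  define pos' where "pos' = (if pos = 1 then p else pos - 1)"
  have pos': "pos' \<in> {1..p}" "L pos' = t"
    using Suc.prems by (auto simp: pos'_def)
  obtain e where e: "e \<in> {1..p}" "fold swp ms L e = t"
    "bpass (p - 1) (map Sig ms) pos' = (strand (\<lambda>_ _. True) (enumerate (p - 1) ms) L t, e)"
    using bpass_Sig[OF num gens pos'(1), of "p - 1"] pos'(2) by auto
  have vir: "bpass 0 (map Vir [1..<p]) pos = ([], pos')"
    using Suc.prems(1) by (auto simp: bpass_Vir pos'_def)
  have bp: "bpass 0 (map Vir [1..<p] @ map Sig ms) pos = (strand (\<lambda>_ _. True) (enumerate (p - 1) ms) L t, e)"
    using e(3) by (simp add: bpass_append vir[simplified])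
  have "close_iter (map Vir [1..<p] @ map Sig ms) n e =
      concat (map (strand (\<lambda>_ _. True) (enumerate (p - 1) ms) L) [Suc t..<p])"
  \<comment> \<open>Strand \<open>p - 1\<close> must end at position 1, since by \<open>link\<close>
    any other end would be followed by a strand numbered \<open>p\<close>. So \<open>e = 1\<close>
    occurs only at the end of the walk.\<close>
  proof (cases "e = 1")
    case True
    have numM: "numbering p (fold swp ms L)" by (rule numbering_fold[OF num gens])
    have "p - 1 < p" using Suc.prems(3) by simp
    then obtain y where y: "y \<in> {1..p}" "fold swp ms L y = p - 1" by (rule numbering_obtain[OF numM])
    have "y = 1"
    proof (rule ccontr)
      assume "y \<noteq> 1"
      then have y': "y - 1 \<in> {1..<p}" using y(1) by auto
      from bspec[OF link this] have "L (y - 1) = p" using y by auto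
      then show False using numbering_less[OF num, of "y - 1"] y' by simp
    qed
    with True e(2) y(2) have "t = p - 1" by simp
    with Suc.prems(3) have "n = 0" by linarith
    with \<open>t = p - 1\<close> show ?thesis by simp
  next
    case False
    then have "e - 1 \<in> {1..<p}" using e(1) by auto
    from bspec[OF link this] have "L (e - 1) = Suc t" using e by auto
    then show ?thesis using False e(1) Suc.prems(3) by (intro Suc.IH) auto
  qed
  then show ?case
    using Suc.prems(3) by (simp add: bp[simplified] upt_conv_Cons)
qed simp

text \<open>Whatever \<open>P\<close> is, a step from \<open>m\<close> to \<open>m + 1\<close> has
  weight 1 and a step back weight -1, so the weights telescope.\<close>

lemma tot_strand:
  assumes "numbering p L" "set (map snd ms) \<subseteq> {1..<p}" "x \<in> {1..p}" "y \<in> {1..p}"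
    "fold swp (map snd ms) L y = L x"
  shows "tot (strand P ms L (L x)) = int y - int x"
  using assms
proof (induction ms arbitrary: L x)
  case Nil
  then show ?case using numbering_eq_iff[OF Nil.prems(1,4,3)] by simp
next
  case (Cons km ms)
  obtain k m where km: "km = (k, m)" by (cases km)
  have m: "m \<in> {1..<p}" using Cons.prems km by simp
  define x' where "x' = (if x = m then Suc m else if x = Suc m then m else x)"
  have x': "x' \<in> {1..p}" "swp m L x' = L x" using Cons.prems m by (auto simp: x'_def)
  have "L m = L x \<longleftrightarrow> x = m" "L (Suc m) = L x \<longleftrightarrow> x = Suc m"
    using numbering_eq_iff[OF Cons.prems(1) _ Cons.prems(3), of m]
      numbering_eq_iff[OF Cons.prems(1) _ Cons.prems(3), of "Suc m"] m by auto
  moreover have "tot (strand P ms (swp m L) (L x)) = int y - int x'"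
    using Cons.IH[OF numbering_swp[OF Cons.prems(1) m] _ x'(1) Cons.prems(4)] Cons.prems x'(2) km
    by simp
  ultimately show ?case by (auto simp: km x'_def Let_def)
qed

text \<open>The walk starts at position \<open>p\<close>. Each of the \<open>t\<close> virtual
  passages lowers the position by one without any weight, which accounts for the summand
  \<open>t\<close>.\<close>

lemma tot_strands:
  assumes num: "numbering p L" and gens: "set (map snd ms) \<subseteq> {1..<p}" and L0: "L p = 0"
    and link: "\<forall>x\<in>{1..<p}. L x = Suc (fold swp (map snd ms) L (Suc x))"
    and x: "x \<in> {1..p}" "L x = t"
  shows "tot (concat (map (strand P ms L) [0..<t])) = int x - int p + int t"
  using x
proof (induction t arbitrary: x)
  case 0
  then have "x = p" using numbering_eq_iff[OF num, of x p] L0 by simp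
  then show ?case by simp
next
  case (Suc t)
  have "x \<noteq> p" using Suc.prems L0 by auto
  then have x: "x \<in> {1..<p}" using Suc.prems by simp
  have M: "fold swp (map snd ms) L (Suc x) = t" using bspec[OF link x] Suc.prems by simp
  have "t < p" using numbering_less[OF num Suc.prems(1)] Suc.prems(2) by simp
  then obtain z where z: "z \<in> {1..p}" "L z = t" by (rule numbering_obtain[OF num])
  have "tot (strand P ms L t) = int (Suc x) - int z"
    using tot_strand[OF num gens z(1), of "Suc x" P] x z(2) M by simp
  then show ?case using Suc.IH[OF z] by simp
qed

text \<open>Heights are position plus strand number up to a constant. The two positions differ by 1,
  which the sign in \<open>ind\<close> cancels, so only the numbers remain.\<close>

lemma ind_code:
  assumes num: "numbering p L" and L0: "L p = 0"
    and ms: "ms = ms1 @ (k, m) # ms2"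
    and gens: "set (map snd ms) \<subseteq> {1..<p}" and dist: "distinct (map fst ms)"
    and link: "\<forall>x\<in>{1..<p}. L x = Suc (fold swp (map snd ms) L (Suc x))"
  defines "L1 \<equiv> fold swp (map snd ms1) L"
  defines "w \<equiv> code (\<lambda>_ _. True) p ms L"
  shows "sg w k = 1 \<and> ind w k = int (L1 (Suc m)) - int (L1 m)"
proof -
  have m: "m \<in> {1..p}" "Suc m \<in> {1..p}" "m \<in> {1..<p}" using gens ms by auto
  have gens1: "set (map snd ms1) \<subseteq> {1..<p}" using gens ms by auto
  have num1: "numbering p L1" unfolding L1_def by (rule numbering_fold[OF num gens1])
  have wf: "gc_wf w" unfolding w_def using num gens dist by (intro gc_wf_code)
  \<comment> \<open>In the positive braid the strand leaving the upper position is on top, so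
    \<open>y = m\<close> doubles as the level.\<close>
  have *: "(k, y = m, True) \<in> set w \<and> ht w k (y = m) = int y - int p + int (L1 y)"
    if y: "y \<in> {m, Suc m}" for y
  proof -
    have yp: "y \<in> {1..p}" using y m by blast
    let ?t = "L1 y"
    have tp: "?t < p" using numbering_less[OF num1 yp] .
    then obtain x where x: "x \<in> {1..p}" "L x = ?t" by (rule numbering_obtain[OF num])
    have "L1 m \<noteq> L1 (Suc m)" by (rule numbering_neq[OF num1 m(3)])
    then have "strand (\<lambda>_ _. True) ms L ?t = strand (\<lambda>_ _. True) ms1 L ?t
        @ (k, y = m, True) # strand (\<lambda>_ _. True) ms2 (swp m L1) ?t"
      using y unfolding ms by (auto simp: strand_append L1_def[symmetric] Let_def)
    then have w: "w = (concat (map (strand (\<lambda>_ _. True) ms L) [0..<?t]) @ strand (\<lambda>_ _. True) ms1 L ?t)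
        @ (k, y = m, True) # (strand (\<lambda>_ _. True) ms2 (swp m L1) ?t
          @ concat (map (strand (\<lambda>_ _. True) ms L) [Suc ?t..<p]))" (is "_ = ?A @ _ # ?B")
      unfolding w_def code_def using upt_split[OF tp, of 0] by simp
    have "ht w k (y = m) = tot ?A"
      using ht_split[of ?A k "y = m" True ?B] wf w by metis
    also have "\<dots> = (int x - int p + int ?t) + (int y - int x)"
      using tot_strands[OF num gens L0 link x, of "\<lambda>_ _. True"]
        tot_strand[OF num gens1 x(1) yp, of "\<lambda>_ _. True"] x(2) by (simp add: L1_def)
    finally have ht: "ht w k (y = m) = int y - int p + int (L1 y)" by simp
    have "(k, y = m, True) \<in> set w" by (subst w) simp
    with ht show ?thesis by simp
  qed
  have sg: "sg w k = 1" using *[of m] by (simp add: sg_def)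
  have "ind w k = int (Suc m) - int p + int (L1 (Suc m)) - (int m - int p + int (L1 m)) - 1"
    using *[of m] *[of "Suc m"] sg by (simp add: ind_def)
  then show ?thesis using sg by simp
qed

section \<open>Crossing changes in closed braids and both bounds\<close>

lemma fold_cc:
  assumes "distinct xs"
  shows "fold cc xs w = map (\<lambda>(b, ov, s). if b \<in> set xs then (b, \<not> ov, \<not> s) else (b, ov, s)) w"
  using assms
proof (induction xs arbitrary: w)
  case Nil
  then show ?case by (simp add: case_prod_unfold)
next
  case (Cons a xs)
  have "fold cc (a # xs) w = map (\<lambda>(b, ov, s). if b \<in> set xs then (b, \<not> ov, \<not> s) else (b, ov, s)) (cc a w)"
    using Cons by simp
  also have "\<dots> = map (\<lambda>(b, ov, s). if b \<in> set (a # xs) then (b, \<not> ov, \<not> s) else (b, ov, s)) w"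
    using Cons.prems by (auto simp: cc_def)
  finally show ?case .
qed

lemma vk_cc_equiv:
  assumes "vk_cc n w w'" "vk_equiv w' w''"
  shows "vk_cc n w w''"
  using assms by (cases n) (auto intro: vk_equiv_trans)

lemma vk_cc_fold: "vk_cc (length xs) w (fold cc xs w)"
proof (induction xs rule: rev_induct)
  case (snoc a xs)
  then show ?case by (auto intro!: exI[of _ "fold cc xs w"] exI[of _ a])
qed simp

text \<open>\<open>F\<close> collects the crossings at which the layering \<open>P\<close> disagrees
  with the positive braid; changing exactly these realises \<open>P\<close>.\<close>

lemma strand_flip:
  assumes "\<And>ms1 k m ms2. ms = ms1 @ (k, m) # ms2 \<Longrightarrow>
    k \<in> F \<longleftrightarrow> \<not> P (fold swp (map snd ms1) L m) (fold swp (map snd ms1) L (Suc m))"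
  shows "strand P ms L t =
    map (\<lambda>(b, ov, s). if b \<in> F then (b, \<not> ov, \<not> s) else (b, ov, s)) (strand (\<lambda>_ _. True) ms L t)"
  using assms
proof (induction ms arbitrary: L)
  case (Cons km ms)
  obtain k m where km: "km = (k, m)" by (cases km)
  have "k \<in> F \<longleftrightarrow> \<not> P (L m) (L (Suc m))"
    using Cons.prems[of "[]" k m ms] km by simp
  moreover have "strand P ms (swp m L) t =
    map (\<lambda>(b, ov, s). if b \<in> F then (b, \<not> ov, \<not> s) else (b, ov, s)) (strand (\<lambda>_ _. True) ms (swp m L) t)"
  proof (rule Cons.IH)
    fix ms1 k' m' ms2
    assume "ms = ms1 @ (k', m') # ms2"
    then show "k' \<in> F \<longleftrightarrow> \<not> P (fold swp (map snd ms1) (swp m L) m') (fold swp (map snd ms1) (swp m L) (Suc m'))"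
      using Cons.prems[of "km # ms1" k' m' ms2] km by simp
  qed
  ultimately show ?case by (auto simp: km Let_def)
qed simp

text \<open>Of the braid only the order in which its closure runs through the strands is used. The
  offset \<open>j\<close> allows for labels shifted by preceding virtual letters.\<close>

lemma vk_cc_closed_braid:
  fixes j :: nat
  assumes num: "numbering p L" and L0: "L p = 0"
    and gens: "set ms \<subseteq> {1..<p}"
    and link: "\<forall>x\<in>{1..<p}. L x = Suc (fold swp ms L (Suc x))"
  defines "w \<equiv> code (\<lambda>_ _. True) p (enumerate j ms) L"
  shows "gc_wf w" "vk_cc (length ms div 2) w []" "even (length ms)"
    "vk_cc n w [] \<Longrightarrow> length ms \<le> 2 * n"
proof -
  let ?ms = "enumerate j ms"
  have gens': "set (map snd ?ms) \<subseteq> {1..<p}" and dist: "distinct (map fst ?ms)"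
    and link': "\<forall>x\<in>{1..<p}. L x = Suc (fold swp (map snd ?ms) L (Suc x))"
    using gens link by simp_all
  note ind = ind_code[OF num L0 _ gens' dist link', folded w_def]
  show wf: "gc_wf w" unfolding w_def using num dist gens' by (rule gc_wf_code)
  have lab: "labels w = fst ` set ?ms" unfolding w_def using num dist gens' by (rule labels_code)
  have card: "card (labels w) = length ms"
    unfolding lab set_map[symmetric] distinct_card[OF dist] by simp
  have pos: "sg w k = 1" and nz: "ind w k \<noteq> 0" if "k \<in> labels w" for k
  proof -
    from that obtain m where "(k, m) \<in> set ?ms" unfolding lab by auto
    then obtain ms1 ms2 where s: "?ms = ms1 @ (k, m) # ms2" by (meson split_list)
    from ind[OF s] show "sg w k = 1" by blast
    have m: "set (map snd ms1) \<subseteq> {1..<p}" "m \<in> {1..<p}" using gens' unfolding s by auto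
    have "fold swp (map snd ms1) L m \<noteq> fold swp (map snd ms1) L (Suc m)"
      by (rule numbering_neq[OF numbering_fold[OF num m(1)] m(2)])
    then show "ind w k \<noteq> 0" using ind[OF s] by simp
  qed
  \<comment> \<open>By \<open>ind_code\<close> the index is negative exactly where the strand with
    the larger number passes over, so changing \<open>F\<close> makes the diagram
    descending.\<close>
  define F where "F = {k \<in> labels w. ind w k < 0}"
  define G where "G = {k \<in> labels w. ind w k > 0}"
  have FG: "labels w = F \<union> G" "F \<inter> G = {}" "finite F" "finite G"
    using neq_iff[THEN iffD1, OF nz] by (auto simp: F_def G_def)
  have "finite F" by (simp add: FG)
  then obtain xs where xs: "set xs = F" "distinct xs" using finite_distinct_list by blast
  have "strand (<) ?ms L t = map (\<lambda>(b, ov, s). if b \<in> F then (b, \<not> ov, \<not> s) else (b, ov, s))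
      (strand (\<lambda>_ _. True) ?ms L t)" for t
  proof (rule strand_flip)
    fix ms1 k m ms2
    assume s: "?ms = ms1 @ (k, m) # ms2"
    then have "k \<in> labels w" unfolding lab by force
    then show "k \<in> F \<longleftrightarrow> \<not> fold swp (map snd ms1) L m < fold swp (map snd ms1) L (Suc m)"
      using ind[OF s] nz[of k] by (auto simp: F_def)
  qed
  then have "fold cc xs w = code (<) p ?ms L"
    unfolding fold_cc[OF xs(2)] xs(1) w_def code_def map_concat
    by (simp add: comp_def cong: map_cong)
  also have "vk_equiv \<dots> (descending p (map snd ?ms) L)"
    using descending_eq[OF num gens' dist] by (rule vk_equiv_sym)
  also have "vk_equiv (descending p (map snd ?ms) L) []"
    using gens' link' num L0 by (intro descending_trivial)
  finally have cc: "vk_cc (card F) w []"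
    using vk_cc_equiv[OF vk_cc_fold[of xs w]] distinct_card[OF xs(2)] xs(1) by simp
  have Nil: "index_sum \<phi> [] = 0" for \<phi> by (simp add: index_sum_def)
  \<comment> \<open>All signs are positive, so the vanishing of this invariant says that
    \<open>F\<close> and \<open>G\<close> are equally large.\<close>
  have "index_sum sgn w = 0"
    using vk_cc_invariant[OF cc wf] by (simp add: Nil)
  moreover have "index_sum sgn w = (\<Sum>k\<in>labels w. sgn (ind w k))"
    unfolding index_sum_def by (simp add: pos)
  moreover have "\<dots> = (\<Sum>k\<in>F. sgn (ind w k)) + (\<Sum>k\<in>G. sgn (ind w k))"
    unfolding FG(1) using FG by (intro sum.union_disjoint)
  moreover have "(\<Sum>k\<in>F. sgn (ind w k)) = - int (card F)" by (simp add: F_def)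
  moreover have "(\<Sum>k\<in>G. sgn (ind w k)) = int (card G)" by (simp add: G_def)
  ultimately have "card F = card G" by simp
  moreover have "length ms = card F + card G"
    using card_Un_disjoint[OF FG(3,4,2)] card FG(1) by simp
  ultimately have len: "length ms = 2 * card F" by simp
  show "even (length ms)" "vk_cc (length ms div 2) w []" using len cc by simp_all
  assume n: "vk_cc n w []"
  \<comment> \<open>With positive signs and nonzero indices this sum counts all crossings; it has to
    reach 0 in steps of at most 2.\<close>
  have "index_sum (\<lambda>i. if i = 0 then 0 else 1) w = (\<Sum>k\<in>labels w. 1)"
    unfolding index_sum_def by (intro sum.cong) (simp_all add: pos nz)
  also have "\<dots> = int (length ms)" using card by simp
  finally show "length ms \<le> 2 * n"
    using vk_cc_invariant[OF n wf] by (simp add: Nil)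
qed

section \<open>The permutation of the torus braid\<close>

lemma fold_swp_upt:
  assumes "1 \<le> p"
  shows "fold swp [1..<p] L x = (if 1 \<le> x \<and> x < p then L (Suc x) else if x = p then L 1 else L x)"
  using assms
proof (induction p arbitrary: x rule: dec_induct)
  case (step n)
  have "fold swp [1..<Suc n] L x = swp n (fold swp [1..<n] L) x" using step.hyps by simp
  also have "\<dots> = (if 1 \<le> x \<and> x < Suc n then L (Suc x) else if x = Suc n then L 1 else L x)"
    using step.hyps step.IH[of n] step.IH[of "Suc n"] step.IH[of x]
    by (cases "x = n"; cases "x = Suc n") (auto simp del: One_nat_def)
  finally show ?case .
qed auto

text \<open>Extending \<open>L\<close> periodically turns the cyclic permutation of a block into a
  translation by one.\<close>

lemma fold_swp_torus:
  assumes "1 \<le> p" "\<And>z. L (z + p) = L z" "x \<in> {1..p}"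
  shows "fold swp (concat (replicate n [1..<p])) L x = L (x + n)"
  using assms(3)
proof (induction n arbitrary: x)
  case (Suc n)
  have "concat (replicate (Suc n) [1..<p]) = concat (replicate n [1..<p]) @ [1..<p]"
    by (simp flip: replicate_append_same)
  then have "fold swp (concat (replicate (Suc n) [1..<p])) L x
      = fold swp [1..<p] (fold swp (concat (replicate n [1..<p])) L) x"
    by simp
  also have "\<dots> = L (x + Suc n)"
  proof (cases "x = p")
    case True
    then show ?thesis
      using Suc.IH[of 1] assms(1) assms(2)[of "Suc n"]
      unfolding fold_swp_upt[OF assms(1)] by (simp add: add.commute)
  next
    case False
    then show ?thesis
      using Suc.IH[of "Suc x"] Suc.prems
      unfolding fold_swp_upt[OF assms(1)] by simp
  qed
  finally show ?case .
qed simp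

text \<open>The run with number \<open>t\<close> leaves the virtual block at the position congruent to \<open>- t * q\<close>
  modulo \<open>p\<close>.\<close>

lemma torus_numbering:
  assumes "0 < p" "0 < q" "coprime p q"
  obtains L :: "nat \<Rightarrow> nat" where "numbering p L" "L p = 0" "\<And>z. L (z + p) = L z"
    "\<And>x. x \<in> {1..<p} \<Longrightarrow> L x = Suc (L (x + q))"
proof -
  have uniq: "s = t" if "s < p" "t < p" "p dvd s * q + z" "p dvd t * q + z" for s t z
  proof -
    have "int p dvd int (s * q + z) - int (t * q + z)"
      using that(3,4) by (intro dvd_diff) (simp_all only: of_nat_dvd_iff)
    also have "int (s * q + z) - int (t * q + z) = (int s - int t) * int q"
      by (simp add: algebra_simps)
    finally have "int p dvd int s - int t"
      using assms(3) by (simp add: coprime_dvd_mult_left_iff)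
    then show ?thesis using that(1,2) dvd_imp_le_int[of "int s - int t" "int p"] by (cases "s = t") auto
  qed
  \<comment> \<open>By Bezout \<open>a\<close> is an inverse of \<open>q\<close> modulo
    \<open>p\<close>, so the residue of \<open>- a * z\<close> solves the congruence.\<close>
  have ex: "\<exists>t<p. p dvd t * q + z" for z
  proof -
    obtain a b where ab: "q * a = p * b + gcd q p" using bezout_nat[of q p] assms(2) by auto
    have g: "gcd q p = 1" using assms(3) by (simp add: coprime_iff_gcd_eq_1 gcd.commute)
    define t where "t = nat ((- int a * int z) mod int p)"
    have t: "int t = (- int a * int z) mod int p" using assms(1) by (simp add: t_def)
    have qa: "int q * int a = int p * int b + 1"
      using arg_cong[OF ab, of int] g by simp
    have "(int t * int q + int z) mod int p = (- int a * int z * int q + int z) mod int p"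
      unfolding t by (metis mod_add_left_eq mod_mult_left_eq)
    also have "- int a * int z * int q + int z = - (int q * int a) * int z + int z"
      by (simp add: algebra_simps)
    also have "\<dots> = int p * (- int b * int z)"
      unfolding qa by (simp add: algebra_simps)
    finally have "int p dvd int t * int q + int z" by (metis dvd_eq_mod_eq_0 mod_mult_self1_is_0)
    then have "p dvd t * q + z" by (metis of_nat_add of_nat_dvd_iff of_nat_mult)
    moreover have "t < p" using assms(1) by (simp add: t_def nat_less_iff)
    ultimately show ?thesis by blast
  qed
  define L where "L z = (THE t. t < p \<and> p dvd t * q + z)" for z
  have L: "L z = t" if "t < p" "p dvd t * q + z" for z t
    unfolding L_def using that uniq by (intro the_equality) auto
  have L': "L z < p \<and> p dvd L z * q + z" for z
    using ex[of z] L by metis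
  show thesis
  proof (rule that[of L])
    show "L p = 0" using assms(1) by (intro L) auto
    show "L (z + p) = L z" for z
      using L'[of z] by (intro L) (auto simp flip: add.assoc)
    show "L x = Suc (L (x + q))" if x: "x \<in> {1..<p}" for x
    proof (rule L)
      have d: "p dvd L (x + q) * q + (x + q)" using L' by blast
      then show d': "p dvd Suc (L (x + q)) * q + x" by (simp add: algebra_simps)
      \<comment> \<open>The value \<open>p\<close> would force \<open>p dvd x\<close>; this is why
        position \<open>p\<close> is excluded.\<close>
      have "Suc (L (x + q)) \<noteq> p"
      proof
        assume "Suc (L (x + q)) = p"
        with d' have "p dvd x" by (metis dvd_add_right_iff dvd_triv_left)
        then show False using x by (auto dest: dvd_imp_le)
      qed
      then show "Suc (L (x + q)) < p" using L'[of "x + q"] by linarith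
    qed
    have inj: "inj_on L {1..p}"
    proof (rule inj_onI)
      fix x y assume xy: "x \<in> {1..p}" "y \<in> {1..p}" "L x = L y"
      have "int p dvd int (L x * q + x) - int (L x * q + y)"
        using L'[of x] L'[of y] xy(3) by (intro dvd_diff) (simp_all only: of_nat_dvd_iff)
      then have "int p dvd int x - int y" by simp
      then show "x = y" using xy(1,2) dvd_imp_le_int[of "int x - int y" "int p"] by (cases "x = y") auto
    qed
    have "L ` {1..p} \<subseteq> {0..<p}" using L' by auto
    then have "L ` {1..p} = {0..<p}"
      using inj by (intro card_subset_eq) (auto simp: card_image)
    with inj show "numbering p L" by (simp add: bij_betw_def)
  qed
qed

theorem theorem1p1:
  fixes p q :: nat
  assumes "0 < p" and "0 < q" and "coprime p q"
  shows "virtually_null_homotopic (VT1 p q) \<and>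
         real (vu (VT1 p q)) = real ((p - 1) * (q - 1)) / 2"
proof -
  obtain L where num: "numbering p L" and L0: "L p = 0" and per: "\<And>z. L (z + p) = L z"
    and step: "\<And>x. x \<in> {1..<p} \<Longrightarrow> L x = Suc (L (x + q))"
    using torus_numbering[OF assms] by blast
  define ms where "ms = concat (replicate (q - 1) [1..<p])"
  have gens: "set ms \<subseteq> {1..<p}" by (auto simp: ms_def)
  have link: "\<forall>x\<in>{1..<p}. L x = Suc (fold swp ms L (Suc x))"
  proof
    fix x assume x: "x \<in> {1..<p}"
    \<comment> \<open>The classical blocks translate by \<open>q - 1\<close>; the passage from
      \<open>Suc x\<close> to \<open>x\<close> in the virtual block supplies the missing
      one.\<close>
    have "fold swp ms L (Suc x) = L (Suc x + (q - 1))"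
      unfolding ms_def using x assms(1) per by (intro fold_swp_torus) auto
    then show "L x = Suc (fold swp ms L (Suc x))" using step[OF x] assms(2) by simp
  qed
  have "VT1_braid p q = map Vir [1..<p] @ map Sig ms"
    by (simp add: VT1_braid_def ms_def map_concat)
  \<comment> \<open>The walk starts at position 1, which the virtual block takes to
    \<open>p\<close>, the place of strand 0; labels start at \<open>p - 1\<close>, behind the
    virtual letters.\<close>
  then have w: "VT1 p q = code (\<lambda>_ _. True) p (enumerate (p - 1) ms) L"
    unfolding VT1_def braid_closure_def code_def
    using close_iter_code[OF num gens link, of 1 0 p] assms(1) L0 by simp
  have len: "length ms = (p - 1) * (q - 1)"
    by (simp add: ms_def length_concat sum_list_replicate)
  note K = vk_cc_closed_braid(2,4)[OF num L0 gens link, where j = "p - 1", folded w]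
    and even = vk_cc_closed_braid(3)[OF num L0 gens link]
  have "vu (VT1 p q) = length ms div 2"
    unfolding vu_def using K even by (intro Least_equality) (auto elim!: evenE)
  moreover have "virtually_null_homotopic (VT1 p q)"
    using K(1) by (auto simp: virtually_null_homotopic_def)
  ultimately show ?thesis using even by (simp add: real_of_nat_div len del: of_nat_mult)
qed

end
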